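(* Let $n\ge 1$ and let $p$ be an integer with $1\le p\le n$. Let $\nu_{1,p}$ denote the first (i.e. smallest) eigenvalue of the Dirichlet-to-Neumann operator $T^{[p]}$ on the closed unit ball in $\mathbf{R}^{n+1}$. Then $$\nu_{1,p}=\begin{cases}\dfrac{n+3}{n+1}\,p & \text{if } 1\leq p\leq \dfrac{n+1}{2},\\[2mm] p+1 & \text{if } \dfrac{n+1}{2}\leq p\leq n.\end{cases}$$
   Context: Let $\Omega$ be a compact connected $(n+1)$-dimensional Riemannian manifold with smooth boundary $\Sigma$, let $N$ be the inner unit normal to $\Sigma$, let $J^{\star}:\Lambda^p(\Omega)\to\Lambda^p(\Sigma)$ be the restriction (pull-back to the boundary) of smooth $p$-forms, $i_N$ the interior product with $N$, $\delta$ the codifferential and $\Delta=d\delta+\delta d$ the Hodge Laplacian. For $0\le p\le n$ and $\omega\in\Lambda^p(\Sigma)$ there is a unique $p$-form $\widehat\omega$ on $\Omega$ (the harmonic tangential extension of $\omega$) with $\Delta\widehat\omega=0$ on $\Omega$, $J^{\star}\widehat\omega=\omega$ and $i_N\widehat\omega=0$ on $\Sigma$. One sets $T^{[p]}\omega=-i_N d\widehat\omega$. $T^{[p]}:\Lambda^p(\Sigma)\to\Lambda^p(\Sigma)$ is a self-adjoint, non-negative, elliptic pseudo-differential operator with discrete spectrum $0\le\nu_{1,p}(\Omega)\le\nu_{2,p}(\Omega)\le\dots$ tending to infinity. *)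

theory Defs
  imports "HOL-Analysis.Analysis"
begin

section \<open>Differential forms on subsets of a Euclidean space\<close>

text \<open>
  A field of forms maps a point and a list of tangent vectors to a real number. A \<open>p\<close>-form
  vanishes on lists whose length is not \<open>p\<close> and, when it lives on a set, at points outside that
  set. With this normalisation, equality of forms is equality of functions.
\<close>

type_synonym 'a form = "'a \<Rightarrow> 'a list \<Rightarrow> real"

definition zero_form :: "'a form" where
  "zero_form = (\<lambda>x vs. 0)"

definition add_form :: "'a form \<Rightarrow> 'a form \<Rightarrow> 'a form" where
  "add_form \<alpha> \<beta> = (\<lambda>x vs. \<alpha> x vs + \<beta> x vs)"

definition scale_form :: "real \<Rightarrow> 'a form \<Rightarrow> 'a form" where
  "scale_form c \<alpha> = (\<lambda>x vs. c * \<alpha> x vs)"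

definition alternating_form :: "nat \<Rightarrow> ('a::real_vector list \<Rightarrow> real) \<Rightarrow> bool" where
  "alternating_form p f \<longleftrightarrow>
     (\<forall>vs. length vs \<noteq> p \<longrightarrow> f vs = 0) \<and>
     (\<forall>vs i. length vs = p \<and> i < p \<longrightarrow> linear (\<lambda>v. f (vs[i := v]))) \<and>
     (\<forall>vs i j. length vs = p \<and> i < j \<and> j < p \<and> vs ! i = vs ! j \<longrightarrow> f vs = 0)"

text \<open>The set \<open>U\<close> is meant to be open in the next three definitions.\<close>

primrec Ck_on :: "nat \<Rightarrow> 'a::euclidean_space set \<Rightarrow> ('a \<Rightarrow> real) \<Rightarrow> bool" where
  "Ck_on 0 U f \<longleftrightarrow> continuous_on U f"
| "Ck_on (Suc k) U f \<longleftrightarrow>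
     (\<forall>x\<in>U. f differentiable (at x)) \<and> (\<forall>v. Ck_on k U (\<lambda>x. frechet_derivative f (at x) v))"

definition smooth_on :: "'a::euclidean_space set \<Rightarrow> ('a \<Rightarrow> real) \<Rightarrow> bool" where
  "smooth_on U f \<longleftrightarrow> (\<forall>k. Ck_on k U f)"

definition smooth_form_on :: "nat \<Rightarrow> 'a::euclidean_space set \<Rightarrow> 'a form \<Rightarrow> bool" where
  "smooth_form_on p U \<omega> \<longleftrightarrow>
     (\<forall>x\<in>U. alternating_form p (\<omega> x)) \<and> (\<forall>vs. smooth_on U (\<lambda>x. \<omega> x vs))"

text \<open>
  Smoothness up to the boundary means being the restriction of a smooth form
  on an open neighbourhood.
\<close>

definition forms :: "nat \<Rightarrow> 'a::euclidean_space set \<Rightarrow> 'a form set" where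
  "forms p \<Omega> =
     {\<omega>. (\<forall>x vs. x \<notin> \<Omega> \<longrightarrow> \<omega> x vs = 0) \<and>
         (\<exists>U \<beta>. open U \<and> \<Omega> \<subseteq> U \<and> smooth_form_on p U \<beta> \<and> (\<forall>x\<in>\<Omega>. \<omega> x = \<beta> x))}"

text \<open>
  On a flat domain the constant vector fields commute, so the invariant formula for the exterior
  derivative reduces to its first sum:
  \<open>d\<omega>(v\<^sub>0, \<dots>, v\<^sub>p) = \<Sum>\<^sub>i (-1)\<^sup>i D\<^bsub>v\<^sub>i\<^esub> (\<omega>(v\<^sub>0, \<dots>, v\<^sub>i omitted, \<dots>, v\<^sub>p))\<close>. Similarly, with
  \<open>(e)\<close> an orthonormal basis, \<open>\<delta>\<omega>(v\<^sub>1, \<dots>) = - \<Sum>\<^sub>e D\<^sub>e (\<omega>(e, v\<^sub>1, \<dots>))\<close>. Derivatives are taken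
  within \<open>\<Omega>\<close>, which determines them uniquely on the closed ball, boundary points included.
\<close>

definition exterior_derivative :: "'a::euclidean_space set \<Rightarrow> 'a form \<Rightarrow> 'a form" where
  "exterior_derivative \<Omega> \<omega> = (\<lambda>x vs.
     if x \<in> \<Omega> then
       (\<Sum>i<length vs. (-1) ^ i *
          frechet_derivative (\<lambda>y. \<omega> y (take i vs @ drop (Suc i) vs)) (at x within \<Omega>) (vs ! i))
     else 0)"

definition codifferential :: "'a::euclidean_space set \<Rightarrow> 'a form \<Rightarrow> 'a form" where
  "codifferential \<Omega> \<omega> = (\<lambda>x vs.
     if x \<in> \<Omega> then
       - (\<Sum>e\<in>Basis. frechet_derivative (\<lambda>y. \<omega> y (e # vs)) (at x within \<Omega>) e)
     else 0)"

definition hodge_laplacian :: "'a::euclidean_space set \<Rightarrow> 'a form \<Rightarrow> 'a form" where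
  "hodge_laplacian \<Omega> \<omega> =
     add_form (exterior_derivative \<Omega> (codifferential \<Omega> \<omega>))
              (codifferential \<Omega> (exterior_derivative \<Omega> \<omega>))"


section \<open>The Dirichlet-to-Neumann operator of the closed unit ball\<close>

abbreviation unit_ball :: "'a::euclidean_space set" where
  "unit_ball \<equiv> cball 0 1"

abbreviation unit_sphere :: "'a::euclidean_space set" where
  "unit_sphere \<equiv> sphere 0 1"

definition inner_normal :: "'a::euclidean_space \<Rightarrow> 'a" where
  "inner_normal x = - x"

definition tangent_space :: "'a::euclidean_space \<Rightarrow> 'a set" where
  "tangent_space x = {v. v \<bullet> inner_normal x = 0}"

text \<open>A form on the sphere is normalised to vanish on lists with a non-tangential entry.\<close>

definition pullback_sphere :: "'a::euclidean_space form \<Rightarrow> 'a form" where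
  "pullback_sphere \<omega> = (\<lambda>x vs.
     if x \<in> unit_sphere \<and> set vs \<subseteq> tangent_space x then \<omega> x vs else 0)"

definition sphere_forms :: "nat \<Rightarrow> 'a::euclidean_space form set" where
  "sphere_forms p =
     {pullback_sphere \<beta> | \<beta>. \<exists>U. open U \<and> unit_sphere \<subseteq> U \<and> smooth_form_on p U \<beta>}"

definition normal_contraction :: "'a::euclidean_space form \<Rightarrow> 'a form" where
  "normal_contraction \<omega> = (\<lambda>x vs. if x \<in> unit_sphere then \<omega> x (inner_normal x # vs) else 0)"

definition harmonic_tangential_extension ::
    "nat \<Rightarrow> 'a::euclidean_space form \<Rightarrow> 'a form \<Rightarrow> bool" where
  "harmonic_tangential_extension p \<omega> \<eta> \<longleftrightarrow>
     \<eta> \<in> forms p unit_ball \<and>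
     hodge_laplacian unit_ball \<eta> = zero_form \<and>
     pullback_sphere \<eta> = \<omega> \<and>
     normal_contraction \<eta> = zero_form"

definition dn_operator :: "nat \<Rightarrow> 'a::euclidean_space form \<Rightarrow> 'a form" where
  "dn_operator p \<omega> =
     scale_form (-1) (pullback_sphere (normal_contraction
       (exterior_derivative unit_ball (THE \<eta>. harmonic_tangential_extension p \<omega> \<eta>))))"

text \<open>
  Every smooth form on the sphere has a unique harmonic tangential extension, so \<open>dn_domain p\<close> is
  all of \<open>sphere_forms p\<close>. Spelling out unique existence here keeps the value of \<open>THE\<close> in
  \<open>dn_operator\<close> meaningful without an appeal to that theorem.
\<close>

definition dn_domain :: "nat \<Rightarrow> 'a::euclidean_space form set" where
  "dn_domain p = {\<omega> \<in> sphere_forms p. \<exists>!\<eta>. harmonic_tangential_extension p \<omega> \<eta>}"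

text \<open>The operator is self-adjoint, so real eigenvalues are the only ones to consider.\<close>

definition eigenvalue_on :: "'a form set \<Rightarrow> ('a form \<Rightarrow> 'a form) \<Rightarrow> real \<Rightarrow> bool" where
  "eigenvalue_on D T \<nu> \<longleftrightarrow> (\<exists>\<omega>\<in>D. \<omega> \<noteq> zero_form \<and> T \<omega> = scale_form \<nu> \<omega>)"

definition first_eigenvalue_on :: "'a form set \<Rightarrow> ('a form \<Rightarrow> 'a form) \<Rightarrow> real \<Rightarrow> bool" where
  "first_eigenvalue_on D T \<nu> \<longleftrightarrow> eigenvalue_on D T \<nu> \<and> (\<forall>\<mu>. eigenvalue_on D T \<mu> \<longrightarrow> \<nu> \<le> \<mu>)"

end

(*
  The Hodge Laplacian of the ball acts componentwise. Let eta be a harmonic tangential p-form on the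
  unit ball of R^m with iota_x d eta = mu eta on the sphere, and let E be the Euler derivative.
  Both iota_x eta and iota_x d eta - mu eta vanish on the sphere and have harmonic Laplacian, so they
  are (|x|^2 - 1) psi and (|x|^2 - 1) gamma with (m + 2E) psi = - delta eta and
  (m + 2E) gamma = - delta d eta = d delta eta. As iota_x psi = 0, Cartan's formula gives
  iota_x d psi = (E + p - 1) psi; together with iota_x gamma = - mu psi this yields
      (m + 2E) (E + p - 1) psi = mu (m + 2E - 2) psi.
  Since psi(0) = 0, an energy argument along rays forces psi = 0 if mu < p (m + 2) / m. Once psi = 0,
  also gamma = 0, hence (E + p) eta = mu eta and iota_x eta = 0, which forces eta = 0 if mu < p + 1.
  Both values are attained: p + 1 by iota_x c for a constant (p+1)-form c, and p (m + 2) / m by a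
  quadratic correction of a constant p-form.
*)

theory Submission
  imports Defs
begin

section \<open>Smooth functions and directional derivatives\<close>

text \<open>On a part of \<open>\<psi>\<close> homogeneous of degree k the radial equation reads (m
  + 2k)(k + p - 1) = mu (m + 2k - 2). Degree 1 gives mu = p (m + 2) / m, but degree 0 can give less
  (mu = 0 if p = 1), so degree 0 has to be excluded: that is the role of psi(0) = 0, which holds
  because iota_x eta vanishes at the centre, where |x|^2 - 1 is -1. No expansion into homogeneous
  parts is made. Instead the equation is differentiated once, which removes the constant part and
  turns the zeroth-order coefficient into p (m + 2) - mu m; its positivity is what the energy
  argument needs. In the same way (E + p) eta = mu eta allows only degree mu - p, and degree 0 is
  excluded because a constant form killed by iota_x is zero; hence p + 1. The main obstacle is the
  division by |x|^2 - 1: the quotient must be smooth and must satisfy its Euler equation. A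
  candidate is written down without dividing, and a maximum principle for an equation that
  degenerates at the sphere shows that it is the quotient.\<close>

definition pd :: "'a::euclidean_space \<Rightarrow> ('a \<Rightarrow> real) \<Rightarrow> 'a \<Rightarrow> real" where
  "pd v f x = frechet_derivative f (at x) v"

lemma pd_eqI: "(f has_derivative D) (at x) \<Longrightarrow> pd v f x = D v"
  unfolding pd_def using frechet_derivative_at by metis

lemma smooth_on_differentiable: "smooth_on U f \<Longrightarrow> x \<in> U \<Longrightarrow> f differentiable (at x)"
  unfolding smooth_on_def by (metis Ck_on.simps(2))

lemma smooth_on_has_derivative:
  "smooth_on U f \<Longrightarrow> x \<in> U \<Longrightarrow> (f has_derivative (\<lambda>v. pd v f x)) (at x)"
  unfolding pd_def using smooth_on_differentiable frechet_derivative_works by metis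

lemma smooth_on_pd: "smooth_on U f \<Longrightarrow> smooth_on U (pd v f)"
  unfolding smooth_on_def pd_def by (metis Ck_on.simps(2))

lemma smooth_on_continuous: "smooth_on U f \<Longrightarrow> continuous_on U f"
  unfolding smooth_on_def by (metis Ck_on.simps(1))

lemma linear_pd: "smooth_on U f \<Longrightarrow> x \<in> U \<Longrightarrow> linear (\<lambda>v. pd v f x)"
  using smooth_on_has_derivative has_derivative_linear by blast

lemma Ck_on_cong:
  assumes "open U" "\<And>x. x \<in> U \<Longrightarrow> f x = g x" "Ck_on k U f"
  shows "Ck_on k U g"
  using assms(2,3)
proof (induction k arbitrary: f g)
  case 0
  then show ?case using continuous_on_cong[of U U f g] by simp
next
  case (Suc k)
  have fr: "frechet_derivative f (at x) = frechet_derivative g (at x)"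
    if "x \<in> U" for x
    using frechet_derivative_transform_within_open[of f x U g] Suc.prems that \<open>open U\<close> by auto
  have "g differentiable (at x)" if "x \<in> U" for x
    using Suc.prems that \<open>open U\<close>
    by (metis (no_types, lifting) Ck_on.simps(2) differentiable_def has_derivative_transform_within_open)
  moreover have "Ck_on k U (\<lambda>x. frechet_derivative g (at x) v)" for v
    by (rule Suc.IH[of "\<lambda>x. frechet_derivative f (at x) v"]) (use Suc.prems fr in auto)
  ultimately show ?case by simp
qed

lemma Ck_on_SucI:
  assumes "open U" "\<And>x. x \<in> U \<Longrightarrow> (f has_derivative D x) (at x)" "\<And>v. Ck_on k U (\<lambda>x. D x v)"
  shows "Ck_on (Suc k) U f"
proof -
  have "frechet_derivative f (at x) = D x" if "x \<in> U" for x
    using assms(2) that frechet_derivative_at by metis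
  then have "Ck_on k U (\<lambda>x. frechet_derivative f (at x) v)" for v
    by (intro Ck_on_cong[OF \<open>open U\<close> _ assms(3)[of v]]) auto
  then show ?thesis using assms(2) differentiableI by fastforce
qed

lemma Ck_on_SucD:
  assumes "Ck_on (Suc k) U f"
  shows "\<And>x. x \<in> U \<Longrightarrow> (f has_derivative (\<lambda>v. pd v f x)) (at x)" "\<And>v. Ck_on k U (\<lambda>x. pd v f x)"
  using assms unfolding pd_def by (auto simp: frechet_derivative_works)

lemma Ck_on_add:
  assumes "open U" shows "Ck_on k U f \<Longrightarrow> Ck_on k U g \<Longrightarrow> Ck_on k U (\<lambda>x. f x + g x)"
proof (induction k arbitrary: f g)
  case 0
  then show ?case by (auto intro: continuous_intros)
next
  case (Suc k)
  note f = Ck_on_SucD[OF Suc.prems(1)] and g = Ck_on_SucD[OF Suc.prems(2)]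
  show ?case
    by (rule Ck_on_SucI[OF \<open>open U\<close> has_derivative_add[OF f(1) g(1)] Suc.IH[OF f(2) g(2)]])
qed

lemma Ck_on_decr: "Ck_on (Suc k) U f \<Longrightarrow> Ck_on k U f"
proof (induction k arbitrary: f)
  case 0
  then show ?case
    by (simp add: continuous_on_eq_continuous_within differentiable_imp_continuous_within
        continuous_at_imp_continuous_at_within)
qed auto

lemma Ck_on_mult:
  assumes "open U" shows "Ck_on k U f \<Longrightarrow> Ck_on k U g \<Longrightarrow> Ck_on k U (\<lambda>x. f x * g x)"
proof (induction k arbitrary: f g)
  case 0
  then show ?case by (auto intro: continuous_intros)
next
  case (Suc k)
  note f = Ck_on_SucD[OF Suc.prems(1)] and g = Ck_on_SucD[OF Suc.prems(2)]
  show ?case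
    by (rule Ck_on_SucI[OF \<open>open U\<close> has_derivative_mult[OF f(1) g(1)]])
       \<comment> \<open>The product rule leaves one factor undifferentiated, so that factor is used
         with one order of regularity less.\<close>
       (auto intro!: Ck_on_add[OF \<open>open U\<close>] Suc.IH f(2) g(2) Suc.prems[THEN Ck_on_decr])
qed

lemma Ck_on_const: "Ck_on k U (\<lambda>x. c)"
  by (induction k arbitrary: c) auto

lemma Ck_on_bounded_linear:
  assumes "bounded_linear L" shows "Ck_on k U L"
proof (cases k)
  case 0
  then show ?thesis using assms by (simp add: linear_continuous_on)
next
  case (Suc k)
  have "frechet_derivative L (at x) = L" for x
    using assms bounded_linear_imp_has_derivative frechet_derivative_at by metis
  moreover have "L differentiable (at x)" for x
    using assms bounded_linear_imp_has_derivative differentiableI by blast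
  ultimately show ?thesis using Suc by (auto simp: Ck_on_const)
qed

lemma smooth_on_cong:
  "open U \<Longrightarrow> (\<And>x. x \<in> U \<Longrightarrow> f x = g x) \<Longrightarrow> smooth_on U f \<Longrightarrow> smooth_on U g"
  unfolding smooth_on_def using Ck_on_cong by blast

lemma smooth_on_add: "open U \<Longrightarrow> smooth_on U f \<Longrightarrow> smooth_on U g \<Longrightarrow> smooth_on U (\<lambda>x. f x + g x)"
  unfolding smooth_on_def using Ck_on_add by blast

lemma smooth_on_mult: "open U \<Longrightarrow> smooth_on U f \<Longrightarrow> smooth_on U g \<Longrightarrow> smooth_on U (\<lambda>x. f x * g x)"
  unfolding smooth_on_def using Ck_on_mult by blast

lemma smooth_on_const: "smooth_on U (\<lambda>x. c)"
  unfolding smooth_on_def by (simp add: Ck_on_const)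

lemma smooth_on_linear:
  fixes L :: "'a::euclidean_space \<Rightarrow> real"
  shows "linear L \<Longrightarrow> smooth_on U L"
  unfolding smooth_on_def by (simp add: Ck_on_bounded_linear linear_conv_bounded_linear)

lemma smooth_on_uminus: "open U \<Longrightarrow> smooth_on U f \<Longrightarrow> smooth_on U (\<lambda>x. - f x)"
  using smooth_on_mult[OF _ smooth_on_const[of U "-1"]] by simp

lemma smooth_on_diff: "open U \<Longrightarrow> smooth_on U f \<Longrightarrow> smooth_on U g \<Longrightarrow> smooth_on U (\<lambda>x. f x - g x)"
  using smooth_on_add[OF _ _ smooth_on_uminus] by simp

lemma smooth_on_sum:
  "open U \<Longrightarrow> (\<And>i. i \<in> I \<Longrightarrow> smooth_on U (f i)) \<Longrightarrow> smooth_on U (\<lambda>x. \<Sum>i\<in>I. f i x)"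
  by (induction I rule: infinite_finite_induct) (auto simp: smooth_on_const intro: smooth_on_add)

lemma smooth_on_inner: "smooth_on U (\<lambda>x. x \<bullet> v)"
  by (rule smooth_on_linear) (rule bounded_linear.linear[OF bounded_linear_inner_left])

lemma Ck_on_subset: "Ck_on k U f \<Longrightarrow> V \<subseteq> U \<Longrightarrow> Ck_on k V f"
  by (induction k arbitrary: f) (auto intro: continuous_on_subset)

lemma smooth_on_subset: "smooth_on U f \<Longrightarrow> V \<subseteq> U \<Longrightarrow> smooth_on V f"
  unfolding smooth_on_def using Ck_on_subset by blast

lemma pd_cong:
  assumes "open U" "\<And>y. y \<in> U \<Longrightarrow> f y = g y" "smooth_on U f" "x \<in> U"
  shows "pd v f x = pd v g x"
  unfolding pd_def using frechet_derivative_transform_within_open[of f x U g] assms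
    smooth_on_differentiable by metis

lemma pd_const: "pd v (\<lambda>x. c) x = 0"
  by (simp add: pd_def)

lemma pd_linear:
  fixes L :: "'a::euclidean_space \<Rightarrow> real"
  assumes "linear L" shows "pd v L x = L v"
  using pd_eqI[OF bounded_linear_imp_has_derivative] assms by (simp add: linear_conv_bounded_linear)

lemma pd_inner: "pd v (\<lambda>x. x \<bullet> w) x = v \<bullet> w"
  by (rule pd_linear) (rule bounded_linear.linear[OF bounded_linear_inner_left])

lemma pd_add:
  "smooth_on U f \<Longrightarrow> smooth_on U g \<Longrightarrow> x \<in> U \<Longrightarrow> pd v (\<lambda>x. f x + g x) x = pd v f x + pd v g x"
  by (rule pd_eqI[OF has_derivative_add]) (auto intro: smooth_on_has_derivative)

lemma pd_diff:
  "smooth_on U f \<Longrightarrow> smooth_on U g \<Longrightarrow> x \<in> U \<Longrightarrow> pd v (\<lambda>x. f x - g x) x = pd v f x - pd v g x"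
  by (rule pd_eqI[OF has_derivative_diff]) (auto intro: smooth_on_has_derivative)

lemma pd_uminus: "smooth_on U f \<Longrightarrow> x \<in> U \<Longrightarrow> pd v (\<lambda>x. - f x) x = - pd v f x"
  by (rule pd_eqI[OF has_derivative_minus]) (auto intro: smooth_on_has_derivative)

lemma pd_mult:
  "smooth_on U f \<Longrightarrow> smooth_on U g \<Longrightarrow> x \<in> U
   \<Longrightarrow> pd v (\<lambda>x. f x * g x) x = f x * pd v g x + pd v f x * g x"
  by (rule pd_eqI[OF has_derivative_mult]) (auto intro: smooth_on_has_derivative)

lemma pd_cmult: "smooth_on U f \<Longrightarrow> x \<in> U \<Longrightarrow> pd v (\<lambda>x. c * f x) x = c * pd v f x"
  using pd_mult[OF smooth_on_const] by (simp add: pd_const)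

lemma pd_sum:
  "(\<And>i. i \<in> I \<Longrightarrow> smooth_on U (f i)) \<Longrightarrow> x \<in> U \<Longrightarrow> pd v (\<lambda>x. \<Sum>i\<in>I. f i x) x = (\<Sum>i\<in>I. pd v (f i) x)"
  by (rule pd_eqI[OF has_derivative_sum]) (auto intro: smooth_on_has_derivative)

lemma linear_eq_sum_Basis:
  fixes L :: "'a::euclidean_space \<Rightarrow> real"
  assumes "linear L" shows "L x = (\<Sum>e\<in>Basis. (x \<bullet> e) * L e)"
proof -
  have "L x = L (\<Sum>e\<in>Basis. (x \<bullet> e) *\<^sub>R e)" by (simp add: euclidean_representation)
  then show ?thesis using assms by (simp add: linear_sum linear_cmul)
qed

section \<open>Derivatives along lines and symmetry of second derivatives\<close>

lemma pd_ray:
  assumes "smooth_on U f" "x + t *\<^sub>R v \<in> U"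
  shows "((\<lambda>t. f (x + t *\<^sub>R v)) has_real_derivative pd v f (x + t *\<^sub>R v)) (at t)"
proof -
  have "((\<lambda>t. f (x + t *\<^sub>R v)) has_derivative (\<lambda>s. pd (s *\<^sub>R v) f (x + t *\<^sub>R v))) (at t)"
    by (rule has_derivative_compose[where f = "\<lambda>t. x + t *\<^sub>R v" and g = f and x = t
          and f' = "\<lambda>s. s *\<^sub>R v", OF _ smooth_on_has_derivative[OF assms]])
       (auto intro!: derivative_eq_intros)
  moreover have "pd (s *\<^sub>R v) f (x + t *\<^sub>R v) = s * pd v f (x + t *\<^sub>R v)" for s
    using linear_cmul[OF linear_pd[OF assms]] by simp
  ultimately show ?thesis
    by (simp add: has_field_derivative_def mult.commute[of _ "pd v f (x + t *\<^sub>R v)"])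
qed

text \<open>Two applications of the mean value theorem, first along \<open>w\<close>, then along \<open>v\<close>; the left-hand side is
  symmetric in \<open>v\<close> and \<open>w\<close>, which gives the symmetry of second derivatives.\<close>

lemma mixed_difference:
  assumes sm: "smooth_on U f" and d: "ball x d \<subseteq> U" "t > 0" "t * (norm v + norm w) < d"
  shows "\<exists>y\<in>ball x d. f (x + t *\<^sub>R v + t *\<^sub>R w) - f (x + t *\<^sub>R v) - f (x + t *\<^sub>R w) + f x
     = t * t * pd v (pd w f) y"
proof -
  have inb: "x + r *\<^sub>R v + s *\<^sub>R w \<in> ball x d" if "0 \<le> r" "r \<le> t" "0 \<le> s" "s \<le> t" for r s
  proof -
    have "norm (r *\<^sub>R v + s *\<^sub>R w) \<le> r * norm v + s * norm w"
      using norm_triangle_ineq[of "r *\<^sub>R v" "s *\<^sub>R w"] that by simp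
    also have "\<dots> \<le> t * norm v + t * norm w"
      by (intro add_mono mult_right_mono) (use that in auto)
    also have "\<dots> < d" using d(3) by (simp add: distrib_left)
    finally have "norm (- (r *\<^sub>R v + s *\<^sub>R w)) < d" by (simp only: norm_minus_cancel)
    then show ?thesis by (simp add: dist_norm)
  qed
  let ?g = "\<lambda>s. f ((x + t *\<^sub>R v) + s *\<^sub>R w) - f (x + s *\<^sub>R w)"
  let ?g' = "\<lambda>s. pd w f ((x + t *\<^sub>R v) + s *\<^sub>R w) - pd w f (x + s *\<^sub>R w)"
  have "(?g has_real_derivative ?g' s) (at s)" if "0 \<le> s" "s \<le> t" for s
    by (intro DERIV_diff pd_ray[OF sm]) (use inb[of t s] inb[of 0 s] that d in auto)
  then obtain s where s: "0 < s" "s < t" "?g t - ?g 0 = (t - 0) * ?g' s"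
    using MVT2[OF \<open>t > 0\<close>, of ?g ?g'] by blast
  let ?h = "\<lambda>r. pd w f ((x + s *\<^sub>R w) + r *\<^sub>R v)"
  let ?h' = "\<lambda>r. pd v (pd w f) ((x + s *\<^sub>R w) + r *\<^sub>R v)"
  have inb2: "(x + s *\<^sub>R w) + r *\<^sub>R v \<in> ball x d" if "0 \<le> r" "r \<le> t" for r
    using inb[of r s] that s by (simp add: algebra_simps)
  have "(?h has_real_derivative ?h' r) (at r)" if "0 \<le> r" "r \<le> t" for r
    by (intro pd_ray[OF smooth_on_pd[OF sm]]) (use inb2[of r] that d in auto)
  then obtain r where r: "0 < r" "r < t" "?h t - ?h 0 = (t - 0) * ?h' r"
    using MVT2[OF \<open>t > 0\<close>, of ?h ?h'] by blast
  have "?g' s = ?h t - ?h 0" by (simp add: algebra_simps)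
  then have "?g t - ?g 0 = t * t * ?h' r" using s r by simp
  moreover have "(x + s *\<^sub>R w) + r *\<^sub>R v \<in> ball x d" using inb2[of r] r by simp
  ultimately show ?thesis by (intro bexI[of _ "(x + s *\<^sub>R w) + r *\<^sub>R v"]) auto
qed

lemma pd_commute:
  assumes sm: "smooth_on U f" and "open U" "x \<in> U"
  shows "pd v (pd w f) x = pd w (pd v f) x"
proof (rule ccontr)
  assume ne: "\<not> ?thesis"
  let ?A = "pd v (pd w f)" and ?B = "pd w (pd v f)"
  \<comment> \<open>Half of the supposed gap: a value of \<open>?A\<close> and a value of
    \<open>?B\<close>, each closer than this to its value at \<open>x\<close>, cannot
    coincide.\<close>
  let ?e = "\<bar>?A x - ?B x\<bar> / 2"
  have e: "?e > 0" using ne by auto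
  have ev: "\<forall>\<^sub>F y in nhds x. dist (g y) (g x) < ?e" if "smooth_on U g" for g
  proof -
    have "isCont g x" using that assms smooth_on_continuous continuous_on_eq_continuous_at by blast
    then have "(g \<longlongrightarrow> g x) (nhds x)" by (simp add: isCont_def tendsto_at_iff_tendsto_nhds)
    then show ?thesis using e by (rule tendstoD)
  qed
  have "\<forall>\<^sub>F y in nhds x. y \<in> U \<and> dist (?A y) (?A x) < ?e \<and> dist (?B y) (?B x) < ?e"
    using ev[of ?A] ev[of ?B] eventually_nhds_in_open[OF assms(2,3)] sm
    by (auto simp: smooth_on_pd eventually_conj_iff)
  then obtain d where d: "d > 0"
    "\<And>y. dist y x < d \<Longrightarrow> y \<in> U \<and> dist (?A y) (?A x) < ?e \<and> dist (?B y) (?B x) < ?e"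
    unfolding eventually_nhds_metric by blast
  \<comment> \<open>Small enough for the whole parallelogram to stay in the ball; the summand 1
    covers the case that \<open>v\<close> and \<open>w\<close> are both zero.\<close>
  define t where "t = d / (2 * (norm v + norm w + 1))"
  have N: "norm v + norm w + 1 > 0" by (smt (verit) norm_ge_zero)
  have t: "t > 0" using d N by (simp add: t_def)
  have "t * (norm v + norm w) \<le> t * (norm v + norm w + 1)" using t by simp
  also have "\<dots> = d / 2" using N by (simp add: t_def field_simps)
  finally have t2: "t * (norm v + norm w) < d" using d by simp
  have sub: "ball x d \<subseteq> U" using d(2) by (auto simp: dist_commute)
  obtain y where y: "y \<in> ball x d"
    "f (x + t *\<^sub>R v + t *\<^sub>R w) - f (x + t *\<^sub>R v) - f (x + t *\<^sub>R w) + f x = t * t * ?A y"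
    using mixed_difference[OF sm sub t t2] by blast
  obtain z where z: "z \<in> ball x d"
    "f (x + t *\<^sub>R w + t *\<^sub>R v) - f (x + t *\<^sub>R w) - f (x + t *\<^sub>R v) + f x = t * t * ?B z"
    using mixed_difference[OF sm sub t, of w v] t2 by (auto simp: add.commute)
  have "?A y = ?B z" using y(2) z(2) t by (simp add: algebra_simps)
  moreover have "dist (?A y) (?A x) < ?e" "dist (?B z) (?B x) < ?e"
    using d(2)[of y] d(2)[of z] y(1) z(1) by (simp_all add: dist_commute)
  ultimately show False unfolding dist_real_def by argo
qed

section \<open>Euler derivative and Laplacian\<close>

lemmas smooth_intros = smooth_on_add smooth_on_mult smooth_on_const smooth_on_uminus smooth_on_diff
  smooth_on_sum smooth_on_inner smooth_on_pd

definition eul :: "('a::euclidean_space \<Rightarrow> real) \<Rightarrow> 'a \<Rightarrow> real" where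
  "eul f x = pd x f x"

definition lap :: "('a::euclidean_space \<Rightarrow> real) \<Rightarrow> 'a \<Rightarrow> real" where
  "lap f x = (\<Sum>e\<in>Basis. pd e (pd e f) x)"

lemma eul_eq_sum: "smooth_on U f \<Longrightarrow> x \<in> U \<Longrightarrow> eul f x = (\<Sum>e\<in>Basis. (x \<bullet> e) * pd e f x)"
  unfolding eul_def by (rule linear_eq_sum_Basis) (rule linear_pd)

lemma eul_add:
  "smooth_on U f \<Longrightarrow> smooth_on U g \<Longrightarrow> x \<in> U \<Longrightarrow> eul (\<lambda>x. f x + g x) x = eul f x + eul g x"
  unfolding eul_def by (rule pd_add)

lemma eul_cmult: "smooth_on U f \<Longrightarrow> x \<in> U \<Longrightarrow> eul (\<lambda>x. c * f x) x = c * eul f x"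
  unfolding eul_def by (rule pd_cmult)

lemma smooth_on_eul: "open U \<Longrightarrow> smooth_on U f \<Longrightarrow> smooth_on U (eul f)"
  by (rule smooth_on_cong[of U "\<lambda>x. \<Sum>e\<in>Basis. (x \<bullet> e) * pd e f x"])
     (auto simp: eul_eq_sum intro!: smooth_intros)

lemma smooth_on_lap: "open U \<Longrightarrow> smooth_on U f \<Longrightarrow> smooth_on U (lap f)"
  unfolding lap_def by (intro smooth_intros)

lemma eul_0: "smooth_on U f \<Longrightarrow> 0 \<in> U \<Longrightarrow> eul f 0 = 0"
  unfolding eul_def using linear_0[OF linear_pd] by blast

lemma eul_cong:
  "open U \<Longrightarrow> (\<And>y. y \<in> U \<Longrightarrow> f y = g y) \<Longrightarrow> smooth_on U f \<Longrightarrow> x \<in> U \<Longrightarrow> eul f x = eul g x"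
  unfolding eul_def by (rule pd_cong)

lemma lap_cong:
  assumes "open U" "\<And>y. y \<in> U \<Longrightarrow> f y = g y" "smooth_on U f" "x \<in> U"
  shows "lap f x = lap g x"
  unfolding lap_def
  by (intro sum.cong refl pd_cong[OF \<open>open U\<close>] assms smooth_on_pd)

lemma pd_pd_cong:
  assumes "open U" "\<And>y. y \<in> U \<Longrightarrow> pd v f y = g y" "smooth_on U f" "x \<in> U"
  shows "pd w (pd v f) x = pd w g x"
  by (intro pd_cong[OF \<open>open U\<close>] assms smooth_on_pd)

text \<open>Differentiation lowers the degree of homogeneity by one, so its commutator with the
  Euler derivative is itself. This commutator shifts the coefficients whenever an Euler equation is
  differentiated.\<close>

lemma pd_eul:
  assumes "open U" "smooth_on U f" "x \<in> U"
  shows "pd v (eul f) x = eul (pd v f) x + pd v f x"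
proof -
  have "pd v (eul f) x = pd v (\<lambda>x. \<Sum>e\<in>Basis. (x \<bullet> e) * pd e f x) x"
    by (intro pd_cong[OF \<open>open U\<close>] assms smooth_on_eul) (simp add: eul_eq_sum[OF assms(2)])
  also have "\<dots> = (\<Sum>e\<in>Basis. pd v (\<lambda>x. (x \<bullet> e) * pd e f x) x)"
    by (rule pd_sum[of _ U]) (use assms in \<open>auto intro!: smooth_intros\<close>)
  also have "\<dots> = (\<Sum>e\<in>Basis. (x \<bullet> e) * pd e (pd v f) x + (v \<bullet> e) * pd e f x)"
  proof (rule sum.cong[OF refl])
    fix e :: 'a
    have "pd v (\<lambda>x. (x \<bullet> e) * pd e f x) x = (x \<bullet> e) * pd v (pd e f) x + (v \<bullet> e) * pd e f x"
      using pd_mult[OF smooth_on_inner smooth_on_pd[OF assms(2)] assms(3)] by (simp add: pd_inner)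
    then show "pd v (\<lambda>x. (x \<bullet> e) * pd e f x) x = (x \<bullet> e) * pd e (pd v f) x + (v \<bullet> e) * pd e f x"
      by (simp add: pd_commute[OF assms(2,1,3), of v])
  qed
  also have "\<dots> = eul (pd v f) x + pd v f x"
    by (simp add: sum.distrib eul_eq_sum[OF smooth_on_pd[OF assms(2)] assms(3)]
        linear_eq_sum_Basis[OF linear_pd[OF assms(2,3)], of v])
  finally show ?thesis .
qed

lemma lap_add:
  assumes "open U" "smooth_on U f" "smooth_on U g" "x \<in> U"
  shows "lap (\<lambda>x. f x + g x) x = lap f x + lap g x"
proof -
  have "pd e (pd e (\<lambda>x. f x + g x)) x = pd e (pd e f) x + pd e (pd e g) x" for e
    using pd_pd_cong[OF assms(1) pd_add[OF assms(2,3)], of x e e] assms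
    by (simp add: pd_add[of U] smooth_intros)
  then show ?thesis by (simp add: lap_def sum.distrib)
qed

lemma lap_mult:
  assumes "open U" "smooth_on U f" "smooth_on U g" "x \<in> U"
  shows "lap (\<lambda>x. f x * g x) x
    = f x * lap g x + 2 * (\<Sum>e\<in>Basis. pd e f x * pd e g x) + lap f x * g x"
proof -
  have "pd e (pd e (\<lambda>x. f x * g x)) x
      = f x * pd e (pd e g) x + 2 * (pd e f x * pd e g x) + pd e (pd e f) x * g x" for e
  proof -
    have "pd e (pd e (\<lambda>x. f x * g x)) x = pd e (\<lambda>x. f x * pd e g x + pd e f x * g x) x"
      by (intro pd_pd_cong[OF assms(1) pd_mult[OF assms(2,3)]] assms smooth_intros)
    also have "\<dots> = pd e (\<lambda>x. f x * pd e g x) x + pd e (\<lambda>x. pd e f x * g x) x"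
      by (rule pd_add) (use assms in \<open>auto intro!: smooth_intros\<close>)
    finally show ?thesis using assms by (simp add: pd_mult[of U] smooth_on_pd)
  qed
  then show ?thesis by (simp add: lap_def sum.distrib sum_distrib_left sum_distrib_right)
qed

lemma lap_const: "lap (\<lambda>x. c) x = 0"
proof -
  have "pd e (\<lambda>x. c) = (\<lambda>x. 0)" for e :: 'a by (rule ext) (rule pd_const)
  then show ?thesis by (simp add: lap_def pd_const)
qed

lemma lap_linear:
  fixes L :: "'a::euclidean_space \<Rightarrow> real"
  assumes "linear L" shows "lap L x = 0"
proof -
  have "pd e L = (\<lambda>x. L e)" for e by (rule ext) (rule pd_linear[OF assms])
  then show ?thesis by (simp add: lap_def pd_const)
qed

lemma lap_cmult:
  "open U \<Longrightarrow> smooth_on U f \<Longrightarrow> x \<in> U \<Longrightarrow> lap (\<lambda>x. c * f x) x = c * lap f x"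
  using lap_mult[OF _ smooth_on_const[of U c], of f x] by (simp add: lap_const pd_const)

lemma lap_diff:
  assumes "open U" "smooth_on U f" "smooth_on U g" "x \<in> U"
  shows "lap (\<lambda>x. f x - g x) x = lap f x - lap g x"
  using lap_add[OF assms(1,2) smooth_on_uminus[OF assms(1,3)] assms(4)]
    lap_cmult[OF assms(1,3,4), of "-1"] by simp

lemma lap_sum:
  assumes "open U" "\<And>i. i \<in> I \<Longrightarrow> smooth_on U (f i)" "x \<in> U"
  shows "lap (\<lambda>x. \<Sum>i\<in>I. f i x) x = (\<Sum>i\<in>I. lap (f i) x)"
  using assms(2)
proof (induction I rule: infinite_finite_induct)
  case (insert i I)
  then show ?case
    using lap_add[OF assms(1), of "f i" "\<lambda>x. \<Sum>i\<in>I. f i x" x] assms(1,3)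
    by (simp add: smooth_on_sum)
qed (auto simp: lap_const)

lemma lap_linear_mult:
  fixes L :: "'a::euclidean_space \<Rightarrow> real"
  assumes "open U" "linear L" "smooth_on U g" "x \<in> U"
  shows "lap (\<lambda>x. L x * g x) x = L x * lap g x + 2 * (\<Sum>e\<in>Basis. L e * pd e g x)"
  using lap_mult[OF assms(1) smooth_on_linear[OF assms(2)] assms(3,4)]
  by (simp add: lap_linear[OF assms(2)] pd_linear[OF assms(2)])

lemma linear_inner_left: "linear (\<lambda>x. x \<bullet> v)"
  by (rule bounded_linear.linear[OF bounded_linear_inner_left])

lemma lap_inner_mult:
  assumes "open U" "smooth_on U g" "x \<in> U"
  shows "lap (\<lambda>x. (x \<bullet> v) * g x) x = (x \<bullet> v) * lap g x + 2 * pd v g x"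
  using lap_linear_mult[OF assms(1) linear_inner_left[of v] assms(2,3)]
    linear_eq_sum_Basis[OF linear_pd[OF assms(2,3)], of v] by (simp add: inner_commute[of v])

text \<open>Two uses of \<open>pd_eul\<close> in each coordinate direction: the Laplacian lowers the
  degree of homogeneity by two.\<close>

lemma lap_eul:
  assumes "open U" "smooth_on U f" "x \<in> U"
  shows "lap (eul f) x = eul (lap f) x + 2 * lap f x"
proof -
  have "pd e (pd e (eul f)) x = eul (pd e (pd e f)) x + 2 * pd e (pd e f) x" for e
  proof -
    have "pd e (pd e (eul f)) x = pd e (\<lambda>x. eul (pd e f) x + pd e f x) x"
      by (rule pd_pd_cong[OF assms(1) pd_eul[OF assms(1,2)] smooth_on_eul[OF assms(1,2)] assms(3)])
    also have "\<dots> = pd e (eul (pd e f)) x + pd e (pd e f) x"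
      by (rule pd_add) (use assms in \<open>auto intro!: smooth_intros smooth_on_eul\<close>)
    finally show ?thesis using assms by (simp add: pd_eul[of U] smooth_on_pd)
  qed
  moreover have "(\<Sum>e\<in>Basis. eul (pd e (pd e f)) x) = eul (lap f) x"
    unfolding eul_def lap_def
    by (rule pd_sum[of _ U, symmetric]) (use assms in \<open>auto intro!: smooth_intros\<close>)
  ultimately show ?thesis by (simp add: lap_def[of "eul f"] sum.distrib lap_def[of f] sum_distrib_left)
qed

lemma pd_lap:
  assumes "open U" "smooth_on U f" "x \<in> U"
  shows "pd v (lap f) x = lap (pd v f) x"
proof -
  have "pd v (pd e (pd e f)) x = pd e (pd e (pd v f)) x" for e
  proof -
    have "pd v (pd e (pd e f)) x = pd e (pd v (pd e f)) x"
      by (rule pd_commute) (use assms in \<open>auto intro!: smooth_intros\<close>)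
    also have "\<dots> = pd e (pd e (pd v f)) x"
      by (rule pd_pd_cong[OF assms(1) pd_commute]) (use assms in \<open>auto intro!: smooth_intros\<close>)
    finally show ?thesis .
  qed
  moreover have "pd v (lap f) x = (\<Sum>e\<in>Basis. pd v (pd e (pd e f)) x)"
    unfolding lap_def by (rule pd_sum) (use assms in \<open>auto intro!: smooth_intros\<close>)
  ultimately show ?thesis by (simp add: lap_def)
qed

text \<open>A defining function of the ball, negative inside and zero on the sphere. The quadratic
  choice is smooth at the centre and has constant Laplacian.\<close>

definition bdf :: "'a::euclidean_space \<Rightarrow> real" where
  "bdf x = x \<bullet> x - 1"

lemma has_derivative_bdf: "(bdf has_derivative (\<lambda>v. 2 * (v \<bullet> x))) (at x)"
  unfolding bdf_def by (auto intro!: derivative_eq_intros simp: inner_commute)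

lemma pd_bdf: "pd v bdf x = 2 * (v \<bullet> x)"
  by (rule pd_eqI[OF has_derivative_bdf])

lemma smooth_on_bdf: "smooth_on (U :: 'a::euclidean_space set) bdf"
proof -
  have "smooth_on UNIV (\<lambda>x::'a. (\<Sum>e\<in>Basis. (x \<bullet> e) * (x \<bullet> e)) - 1)"
    by (intro smooth_intros) auto
  then have "smooth_on UNIV (bdf :: 'a \<Rightarrow> real)"
    unfolding bdf_def by (subst euclidean_inner) simp
  then show ?thesis by (rule smooth_on_subset) simp
qed

lemma lap_bdf: "lap bdf (x::'a::euclidean_space) = 2 * DIM('a)"
proof -
  have "pd e (pd e bdf) x = 2" if "e \<in> Basis" for e :: 'a
  proof -
    have "pd e bdf = (\<lambda>x. x \<bullet> (2 *\<^sub>R e))" by (rule ext) (simp add: pd_bdf inner_commute)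
    then show ?thesis using that by (simp only: pd_inner) simp
  qed
  then show ?thesis by (simp add: lap_def)
qed

text \<open>For harmonic \<open>g\<close> only twice the operator m + 2E applied to \<open>g\<close>
  remains; this is the origin of that operator in the whole argument.\<close>

lemma lap_bdf_mult:
  fixes x :: "'a::euclidean_space"
  assumes "open U" "smooth_on U g" "x \<in> U"
  shows "lap (\<lambda>x. bdf x * g x) x
    = bdf x * lap g x + 4 * eul g x + 2 * real DIM('a) * g x"
  unfolding lap_mult[OF assms(1) smooth_on_bdf assms(2,3)]
  by (simp add: lap_bdf pd_bdf eul_eq_sum[OF assms(2,3)] sum_distrib_left inner_commute mult.assoc)

lemma eul_bdf_mult:
  assumes "smooth_on U g" "x \<in> U"
  shows "eul (\<lambda>x. bdf x * g x) x = bdf x * eul g x + 2 * (bdf x + 1) * g x"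
  unfolding eul_def pd_mult[OF smooth_on_bdf assms] by (simp add: pd_bdf bdf_def)

lemma bdf_neg: "x \<in> ball 0 1 \<Longrightarrow> bdf x < 0"
  by (simp add: bdf_def dot_square_norm power_less_one_iff)

lemma bdf_sphere: "x \<in> sphere 0 1 \<Longrightarrow> bdf x = 0"
  by (simp add: bdf_def dot_square_norm)

lemma continuous_on_bdf: "continuous_on A bdf"
  unfolding bdf_def by (intro continuous_intros)

section \<open>Maximum principles on the ball\<close>

lemma local_min_pd:
  assumes "open U" "smooth_on U K" "z \<in> U" and min: "\<And>x. x \<in> U \<Longrightarrow> K z \<le> K x"
  shows "pd v K z = 0" "pd v (pd v K) z \<ge> 0"
proof -
  let ?k = "\<lambda>t. K (z + t *\<^sub>R v)" and ?k' = "\<lambda>t. pd v K (z + t *\<^sub>R v)"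
  have "\<forall>\<^sub>F t in nhds 0. z + t *\<^sub>R v \<in> U"
    by (rule eventually_compose_filterlim[OF eventually_nhds_in_open[OF assms(1,3)]])
       (auto intro!: tendsto_eq_intros filterlim_ident)
  then obtain d where d: "d > 0" "\<And>t. \<bar>t\<bar> < d \<Longrightarrow> z + t *\<^sub>R v \<in> U"
    unfolding eventually_nhds_metric by auto
  have D: "(?k has_real_derivative ?k' t) (at t)" if "\<bar>t\<bar> < d" for t
    by (rule pd_ray[OF assms(2) d(2)[OF that]])
  have 0: "?k' 0 = 0"
    by (rule DERIV_local_min[OF D[of 0] d(1)]) (use d min in auto)
  then show "pd v K z = 0" by simp
  show "pd v (pd v K) z \<ge> 0"
  proof (rule ccontr)
    assume "\<not> ?thesis"
    then have neg: "pd v (pd v K) (z + 0 *\<^sub>R v) < 0" by simp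
    have "(?k' has_real_derivative pd v (pd v K) (z + 0 *\<^sub>R v)) (at 0)"
      by (rule pd_ray[OF smooth_on_pd[OF assms(2)]]) (use assms in auto)
    \<comment> \<open>The first derivative is zero at the minimum and decreasing there, hence
      negative just to the right; the mean value theorem then pushes \<open>K\<close> below its
      minimum.\<close>
    from DERIV_neg_dec_right[OF this neg] obtain e where
      e: "e > 0" "\<And>h. 0 < h \<Longrightarrow> h < e \<Longrightarrow> ?k' h < 0" using 0 by auto
    define t where "t = min d e / 2"
    have t: "t > 0" "t < d" "t < e" using d e by (auto simp: t_def)
    obtain s where s: "0 < s" "s < t" "?k t - ?k 0 = (t - 0) * ?k' s"
      using MVT2[OF t(1), of ?k ?k'] D t by force
    have "?k' s < 0" using e(2)[of s] s t by simp
    then have "?k t - ?k 0 < 0" using s t by (simp add: mult_pos_neg)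
    then show False using min[OF d(2)[of t]] t by simp
  qed
qed

text \<open>The weak maximum principle, applied to \<open>g\<close> and to its negative. It yields
  the uniqueness of harmonic tangential extensions and so fixes the value of \<open>THE\<close> in
  \<open>dn_operator\<close>.\<close>

lemma harmonic_zero_boundary:
  fixes g :: "'a::euclidean_space \<Rightarrow> real"
  assumes U: "open U" "cball 0 1 \<subseteq> U" and g: "smooth_on U g"
    and harm: "\<And>x. x \<in> ball 0 1 \<Longrightarrow> lap g x = 0"
    and bdry: "\<And>x. x \<in> sphere 0 1 \<Longrightarrow> g x = 0"
    and x: "x \<in> cball 0 1"
  shows "g x = 0"
proof -
  have nonpos: "g x0 \<le> 0" if g: "smooth_on U g"
    and harm: "\<And>x. x \<in> ball 0 1 \<Longrightarrow> lap g x = 0"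
    and bdry: "\<And>x. x \<in> sphere 0 1 \<Longrightarrow> g x = 0"
    and x0: "x0 \<in> cball 0 1" for g :: "'a \<Rightarrow> real" and x0
  proof (rule ccontr)
    assume "\<not> ?thesis"
    then have pos: "g x0 > 0" by simp
    \<comment> \<open>Adding \<open>c * bdf\<close> makes the Laplacian strictly positive inside,
      which an interior maximum forbids. As \<open>bdf\<close> is at least -1, half of
      \<open>g x0\<close> is small enough to keep \<open>u x0\<close> positive.\<close>
    define c where "c = g x0 / 2"
    have c: "c > 0" using pos by (simp add: c_def)
    define u where "u = (\<lambda>x. g x + c * bdf x)"
    have su: "smooth_on U u" unfolding u_def using U g by (intro smooth_intros smooth_on_bdf)
    have "continuous_on (cball 0 1) u"
      using continuous_on_subset[OF smooth_on_continuous[OF su] U(2)] .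
    then obtain z where z: "z \<in> cball 0 1" "\<And>y. y \<in> cball 0 1 \<Longrightarrow> u y \<le> u z"
      using continuous_attains_sup[of "cball 0 1" u] by auto
    have "bdf x0 \<ge> -1" by (simp add: bdf_def)
    then have "u x0 > 0" using pos c mult_left_mono[of "-1" "bdf x0" c] by (simp add: u_def c_def)
    then have "u z > 0" using z(2)[OF x0] by simp
    then have "z \<notin> sphere 0 1" using bdry bdf_sphere by (force simp: u_def)
    then have zb: "z \<in> ball 0 1" using z(1) by auto
    define K where "K = (\<lambda>x. 0 - u x)"
    have sub: "ball 0 1 \<subseteq> U" using U(2) by auto
    have sK: "smooth_on (ball 0 1) K" unfolding K_def
      by (intro smooth_intros smooth_on_subset[OF su sub]) auto
    have "pd e (pd e K) z \<ge> 0" for e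
      by (rule local_min_pd(2)[OF _ sK zb]) (use z(2) in \<open>auto simp: K_def\<close>)
    then have "lap K z \<ge> 0" unfolding lap_def by (intro sum_nonneg) auto
    moreover have "lap K z = - lap u z"
      unfolding K_def using lap_diff[OF U(1) smooth_on_const su, of z 0] zb sub by (auto simp: lap_const)
    moreover have "lap u z = lap g z + c * lap bdf z"
      unfolding u_def using zb sub U g
      by (simp add: lap_add[of U] lap_cmult[of U] smooth_intros smooth_on_bdf subset_iff)
    moreover have "c * real DIM('a) > 0" using c by simp
    ultimately show False using harm[OF zb] by (simp add: lap_bdf)
  qed
  have "lap (\<lambda>x. - g x) y = 0" if "y \<in> ball 0 1" for y
    using lap_cmult[OF U(1) g, of y "-1"] that harm U(2) by (auto simp: subset_iff)
  then have "- g x \<le> 0"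
    by (intro nonpos[of "\<lambda>x. - g x"]) (use U g bdry x in \<open>auto intro!: smooth_intros\<close>)
  then show ?thesis using nonpos[OF g harm bdry x] by simp
qed

text \<open>A function that vanishes on the sphere together with its radial derivative is o(1 -
  |x|): the mean value theorem along the radius, uniformly in the direction by compactness. It
  replaces boundary regularity of the quotient, about which nothing is known yet.\<close>

lemma boundary_quotient_small:
  fixes R :: "'a::euclidean_space \<Rightarrow> real"
  assumes U: "open U" "cball 0 1 \<subseteq> U" and R: "smooth_on U R"
    and bdry: "\<And>x. x \<in> sphere 0 1 \<Longrightarrow> R x = 0" "\<And>x. x \<in> sphere 0 1 \<Longrightarrow> eul R x = 0"
    and "\<epsilon> > 0"
  shows "\<exists>r<1. \<forall>x. r \<le> norm x \<and> norm x < 1 \<longrightarrow> \<bar>R x / bdf x\<bar> < \<epsilon>"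
proof -
  have "continuous_on (cball 0 1) (eul R)"
    using continuous_on_subset[OF smooth_on_continuous[OF smooth_on_eul[OF U(1) R]] U(2)] .
  then have "uniformly_continuous_on (cball 0 1) (eul R)"
    by (rule compact_uniformly_continuous) simp
  then obtain d where d: "d > 0"
    "\<And>x y. x \<in> cball 0 1 \<Longrightarrow> y \<in> cball 0 1 \<Longrightarrow> dist y x < d \<Longrightarrow> dist (eul R y) (eul R x) < \<epsilon> / 2"
    unfolding uniformly_continuous_on_def using \<open>\<epsilon> > 0\<close> by (metis half_gt_zero)
  \<comment> \<open>With \<open>r\<close> at least 1/2, passing from \<open>eul R\<close> to the
    derivative along the unit vector costs at most a factor 2, which the bound
    \<open>\<epsilon> / 2\<close> absorbs. The other bound keeps the intermediate point within
    \<open>d\<close> of the sphere.\<close>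
  define r where "r = max (1/2) (1 - d / 2)"
  have r: "r < 1" "r \<ge> 1/2" "r \<ge> 1 - d / 2" using d by (auto simp: r_def)
  have "\<bar>R x / bdf x\<bar> < \<epsilon>" if x: "r \<le> norm x" "norm x < 1" for x
  proof -
    have nx: "norm x > 0" using x r by linarith
    define y where "y = x /\<^sub>R norm x"
    have y: "norm y = 1" "x = norm x *\<^sub>R y" using nx by (auto simp: y_def)
    have inU: "0 + t *\<^sub>R y \<in> U" if "norm x \<le> t" "t \<le> 1" for t
    proof -
      have "0 \<le> t" using that norm_ge_zero order_trans by blast
      then have "t *\<^sub>R y \<in> cball 0 1" using that y(1) by simp
      then show ?thesis using U(2) by auto
    qed
    obtain t where t: "norm x < t" "t < 1"
      "R (0 + 1 *\<^sub>R y) - R (0 + norm x *\<^sub>R y) = (1 - norm x) * pd y R (0 + t *\<^sub>R y)"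
      using MVT2[OF x(2), of "\<lambda>t. R (0 + t *\<^sub>R y)" "\<lambda>t. pd y R (0 + t *\<^sub>R y)"]
        pd_ray[OF R inU] by blast
    have t0: "t \<ge> 1/2" using t x r by linarith
    have "eul R (t *\<^sub>R y) = t * pd y R (t *\<^sub>R y)"
      unfolding eul_def using linear_cmul[OF linear_pd[OF R inU[of t]]] t by simp
    moreover have "dist (eul R (t *\<^sub>R y)) (eul R y) < \<epsilon> / 2"
    proof (rule d(2))
      have "dist (t *\<^sub>R y) y = norm ((1 - t) *\<^sub>R y)"
        by (simp add: dist_norm norm_minus_commute algebra_simps)
      then show "dist (t *\<^sub>R y) y < d" using t y x r d by simp
    qed (use t t0 y in auto)
    moreover have "eul R y = 0" using bdry(2) y(1) by simp
    ultimately have "\<bar>t * pd y R (t *\<^sub>R y)\<bar> < \<epsilon> / 2" by (simp add: dist_real_def)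
    moreover have "\<bar>t * pd y R (t *\<^sub>R y)\<bar> \<ge> 1/2 * \<bar>pd y R (t *\<^sub>R y)\<bar>"
      unfolding abs_mult by (rule mult_right_mono) (use t0 in auto)
    ultimately have small: "\<bar>pd y R (t *\<^sub>R y)\<bar> < \<epsilon>" by linarith
    have "R x = - ((1 - norm x) * pd y R (t *\<^sub>R y))"
      using t(3) bdry(1)[of y] y by simp
    then have "\<bar>R x\<bar> = (1 - norm x) * \<bar>pd y R (t *\<^sub>R y)\<bar>" using x by (simp add: abs_mult)
    also have "\<dots> < (1 - norm x) * \<epsilon>" using small x by (intro mult_strict_left_mono) auto
    also have "\<dots> \<le> \<bar>bdf x\<bar> * \<epsilon>"
    proof (rule mult_right_mono)
      have "1 - norm x \<le> (1 - norm x) * (1 + norm x)"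
        using x by (simp add: algebra_simps mult_left_le)
      also have "\<dots> = \<bar>bdf x\<bar>" using bdf_neg[of x] x
        by (simp add: bdf_def dot_square_norm power2_eq_square algebra_simps)
      finally show "1 - norm x \<le> \<bar>bdf x\<bar>" .
    qed (use \<open>\<epsilon> > 0\<close> in auto)
    finally show ?thesis using bdf_neg[of x] x by (simp add: field_simps)
  qed
  then show ?thesis using r(1) by blast
qed

text \<open>The quotient \<open>S = R / bdf\<close> satisfies \<open>bdf\<^sup>2 * lap S = 8 * S\<close> and tends to 0 at the boundary, so the
  maximum principle gives \<open>S = 0\<close>. In the proof \<open>S\<close> is never differentiated: at a positive maximum
  \<open>s\<close> of \<open>S\<close> the function \<open>R - s * bdf\<close> has a local minimum.\<close>

lemma degenerate_elliptic_zero: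
  fixes R :: "'a::euclidean_space \<Rightarrow> real"
  assumes U: "open U" "cball 0 1 \<subseteq> U" and R: "smooth_on U R"
    and bdry: "\<And>x. x \<in> sphere 0 1 \<Longrightarrow> R x = 0" "\<And>x. x \<in> sphere 0 1 \<Longrightarrow> eul R x = 0"
    and eq: "\<And>x. x \<in> ball 0 1 \<Longrightarrow>
        bdf x * lap R x = 2 * (2 * eul R x + (real DIM('a) - 4) * R x)"
    and x: "x \<in> ball 0 1"
  shows "R x = 0"
proof -
  have sub: "ball 0 1 \<subseteq> U" using U(2) by auto
  have nonpos: "R x0 / bdf x0 \<le> 0"
    if R: "smooth_on U R" and bdry: "\<And>x. x \<in> sphere 0 1 \<Longrightarrow> R x = 0"
      "\<And>x. x \<in> sphere 0 1 \<Longrightarrow> eul R x = 0"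
    and eq: "\<And>x. x \<in> ball 0 1 \<Longrightarrow>
        bdf x * lap R x = 2 * (2 * eul R x + (real DIM('a) - 4) * R x)"
    and x0: "x0 \<in> ball 0 1" for R :: "'a \<Rightarrow> real" and x0
  proof (rule ccontr)
    assume "\<not> ?thesis"
    then have pos: "R x0 / bdf x0 > 0" by simp
    obtain r where r: "r < 1" "\<And>x. r \<le> norm x \<Longrightarrow> norm x < 1 \<Longrightarrow> \<bar>R x / bdf x\<bar> < R x0 / bdf x0"
      using boundary_quotient_small[OF U R bdry pos] by blast
    \<comment> \<open>Beyond this radius the quotient stays below its value at \<open>x0\<close>, so
      a maximum over the smaller closed ball is one over the whole open ball.\<close>
    define \<rho> where "\<rho> = max r (norm x0)"
    have \<rho>: "\<rho> < 1" "r \<le> \<rho>" "norm x0 \<le> \<rho>" using r x0 by (auto simp: \<rho>_def)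
    have rb: "cball 0 \<rho> \<subseteq> ball (0::'a) 1" using \<rho> by auto
    have "continuous_on (cball 0 \<rho>) (\<lambda>x. R x / bdf x)"
      using bdf_neg rb
      by (intro continuous_intros continuous_on_bdf continuous_on_subset[OF smooth_on_continuous[OF R]])
         (use sub in fastforce)+
    then obtain z where z: "z \<in> cball 0 \<rho>" "\<And>y. y \<in> cball 0 \<rho> \<Longrightarrow> R y / bdf y \<le> R z / bdf z"
      using continuous_attains_sup[of "cball 0 \<rho>" "\<lambda>x. R x / bdf x"] \<rho>
      by (metis cball_eq_empty compact_cball dist_0_norm empty_iff linorder_not_le mem_cball)
    have zb: "z \<in> ball 0 1" using z rb by auto
    define s where "s = R z / bdf z"
    have "s \<ge> R x0 / bdf x0" using z(2)[of x0] \<rho> by (simp add: s_def)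
    then have s0: "s > 0" using pos by simp
    have s: "R y / bdf y \<le> s" if "y \<in> ball 0 1" for y
    proof (cases "norm y \<le> \<rho>")
      case True
      then show ?thesis using z(2)[of y] by (simp add: s_def)
    next
      case False
      then have "\<bar>R y / bdf y\<bar> < R x0 / bdf x0" using r(2)[of y] \<rho> that by simp
      then show ?thesis using \<open>s \<ge> R x0 / bdf x0\<close> by linarith
    qed
    define K where "K = (\<lambda>x. R x - s * bdf x)"
    have Rb: "smooth_on (ball 0 1) R" by (rule smooth_on_subset[OF R sub])
    have sbf: "smooth_on (ball 0 1) (\<lambda>x::'a. s * bdf x)" by (intro smooth_intros smooth_on_bdf) auto
    have sK: "smooth_on (ball 0 1) K" unfolding K_def by (rule smooth_on_diff[OF _ Rb sbf]) auto
    have Kz: "K z = 0" using bdf_neg[OF zb] by (simp add: K_def s_def)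
    have Kpos: "K z \<le> K y" if "y \<in> ball 0 1" for y
      using s[OF that] bdf_neg[OF that] Kz by (simp add: K_def field_simps)
    note lm = local_min_pd[OF _ sK zb Kpos, simplified]
    have "lap K z \<ge> 0" unfolding lap_def using lm(2) by (intro sum_nonneg) auto
    moreover have "lap K z = lap R z - s * (2 * DIM('a))"
      unfolding K_def lap_diff[OF open_ball Rb sbf zb]
      by (simp add: lap_cmult[OF open_ball smooth_on_bdf zb] lap_bdf)
    ultimately have L: "lap R z \<ge> s * (2 * DIM('a))" by simp
    have "pd z K z = eul R z - s * (2 * (z \<bullet> z))"
      unfolding K_def pd_diff[OF Rb sbf zb] eul_def
      by (simp add: pd_cmult[OF smooth_on_bdf zb] pd_bdf)
    then have E: "eul R z = 2 * s * (bdf z + 1)" using lm(1)[of z] by (simp add: bdf_def)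
    have Rz: "R z = s * bdf z" using Kz by (simp add: K_def)
    have "bdf z * lap R z \<le> bdf z * (s * (2 * DIM('a)))"
      using L bdf_neg[OF zb] by (intro mult_left_mono_neg) auto
    \<comment> \<open>Inserting \<open>E\<close> and \<open>Rz\<close> in the equation turns the
      left-hand side into \<open>8 * s\<close> plus the right-hand side; the -4 in its coefficient
      cancels the multiple of \<open>bdf\<close> that comes from \<open>eul R\<close>.\<close>
    then have "8 * s \<le> 0" unfolding eq[OF zb] E Rz by (simp add: algebra_simps)
    then show False using s0 by simp
  qed
  let ?R = "\<lambda>x. - R x"
  have pdm: "eul ?R y = - eul R y" if "y \<in> U" for y
    unfolding eul_def by (rule pd_uminus[OF R that])
  have lapm: "lap ?R y = - lap R y" if "y \<in> U" for y
    using lap_cmult[OF U(1) R that, of "-1"] by simp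
  have "?R x / bdf x \<le> 0"
  proof (rule nonpos[of ?R])
    fix y :: 'a
    show "y \<in> sphere 0 1 \<Longrightarrow> eul ?R y = 0" using pdm[of y] bdry(2)[of y] U(2) by (auto simp: subset_iff)
    assume y: "y \<in> ball 0 1"
    then have "y \<in> U" using sub by auto
    then show "bdf y * lap ?R y = 2 * (2 * eul ?R y + (real DIM('a) - 4) * ?R y)"
      using eq[OF y] by (simp add: pdm lapm algebra_simps)
  qed (use R U bdry x in \<open>auto intro!: smooth_intros\<close>)
  then show ?thesis using nonpos[OF R bdry eq x] bdf_neg[OF x] by (simp add: field_simps)
qed

text \<open>If \<open>\<phi> = bdf * \<psi>\<close> with \<open>\<psi>\<close> harmonic, then \<open>lap \<phi> = 2 * m * \<psi> + 4 * eul \<psi>\<close>, where \<open>m\<close> is the dimension;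
  eliminating \<open>bdf * eul \<psi>\<close> from this and from \<open>eul \<phi>\<close> expresses \<open>\<psi>\<close> through \<open>\<phi>\<close>, \<open>eul \<phi>\<close> and \<open>a\<close>
  without a division. This expression serves as the witness.\<close>

lemma divide_by_bdf:
  fixes \<phi> a :: "'a::euclidean_space \<Rightarrow> real"
  assumes U: "open U" "cball 0 1 \<subseteq> U" and sm: "smooth_on U \<phi>" "smooth_on U a"
    and lap\<phi>: "\<And>x. x \<in> ball 0 1 \<Longrightarrow> lap \<phi> x = 2 * a x"
    and lapa: "\<And>x. x \<in> ball 0 1 \<Longrightarrow> lap a x = 0"
    and bdry: "\<And>x. x \<in> sphere 0 1 \<Longrightarrow> \<phi> x = 0"
  shows "\<exists>\<psi>. smooth_on U \<psi> \<and>
    (\<forall>x\<in>ball 0 1. \<phi> x = bdf x * \<psi> x \<and> real DIM('a) * \<psi> x + 2 * eul \<psi> x = a x)"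
proof -
  let ?m = "real DIM('a)"
  have sub: "ball 0 1 \<subseteq> U" using U(2) by auto
  \<comment> \<open>If \<open>\<phi>\<close> is \<open>bdf * \<psi>\<close>, then
    \<open>eul \<phi>\<close> is \<open>bdf * eul \<psi> + 2 * (bdf + 1) * \<psi>\<close>.
    Substituting this in \<open>bdf * a = m * \<phi> + 2 * bdf * eul \<psi>\<close> gives
    \<open>bdf * a = 2 * eul \<phi> + (m - 4) * \<phi> - 4 * \<psi>\<close>, and solving for
    \<open>\<psi>\<close> yields these coefficients.\<close>
  define A where "A = (\<lambda>x. (1/2) * eul \<phi> x + ((?m - 4) / 4) * \<phi> x)"
  define \<psi> where "\<psi> = (\<lambda>x. A x - (1/4) * (bdf x * a x))"
  define R where "R = (\<lambda>x. \<phi> x - bdf x * \<psi> x)"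
  note sms = U(1) sm smooth_on_eul smooth_intros smooth_on_bdf
  have sA: "smooth_on U A" unfolding A_def by (intro sms)
  have sba: "smooth_on U (\<lambda>x. bdf x * a x)" by (intro sms)
  have s\<psi>: "smooth_on U \<psi>" unfolding \<psi>_def by (intro sms sA)
  have sR: "smooth_on U R" unfolding R_def by (intro sms s\<psi>)
  \<comment> \<open>Harmonicity was assumed in finding the candidate and now has to be verified for
    it.\<close>
  have lap\<psi>: "lap \<psi> x = 0" if x: "x \<in> ball 0 1" for x
  proof -
    have xU: "x \<in> U" using x sub by auto
    have "eul (lap \<phi>) x = eul (\<lambda>x. 2 * a x) x"
      by (rule eul_cong[of "ball 0 1"])
         (use x lap\<phi> smooth_on_subset[OF smooth_on_lap[OF U(1) sm(1)] sub] in auto)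
    also have "\<dots> = 2 * eul a x" unfolding eul_def by (rule pd_cmult[OF sm(2) xU])
    finally have e: "lap (eul \<phi>) x = 2 * eul a x + 4 * a x"
      using lap_eul[OF U(1) sm(1) xU] lap\<phi>[OF x] by simp
    have "lap A x = (1/2) * lap (eul \<phi>) x + ((?m - 4) / 4) * lap \<phi> x"
      unfolding A_def using U(1) sm xU
      by (simp only: lap_add[of U] lap_cmult[of U] smooth_on_eul smooth_on_mult smooth_on_const)
    moreover have "lap \<psi> x = lap A x - (1/4) * lap (\<lambda>x. bdf x * a x) x"
      unfolding \<psi>_def using U(1) sA sba xU
      by (simp only: lap_diff[of U] lap_cmult[of U] smooth_on_mult smooth_on_const)
    ultimately show ?thesis
      using e lap\<phi>[OF x] lapa[OF x] lap_bdf_mult[OF U(1) sm(2) xU] by (simp add: field_simps)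
  qed
  have sb\<psi>: "smooth_on U (\<lambda>x. bdf x * \<psi> x)" by (intro sms s\<psi>)
  have lapR: "lap R x = 2 * a x - 4 * eul \<psi> x - 2 * ?m * \<psi> x" if x: "x \<in> ball 0 1" for x
  proof -
    have xU: "x \<in> U" using x sub by auto
    show ?thesis unfolding R_def lap_diff[OF U(1) sm(1) sb\<psi> xU] lap_bdf_mult[OF U(1) s\<psi> xU]
      using lap\<psi>[OF x] lap\<phi>[OF x] by simp
  qed
  have eulR: "eul R x = eul \<phi> x - (bdf x * eul \<psi> x + 2 * (bdf x + 1) * \<psi> x)" if "x \<in> U" for x
    using pd_diff[OF sm(1) sb\<psi> that, of x] eul_bdf_mult[OF s\<psi> that] by (simp add: R_def eul_def)
  have \<psi>4: "4 * \<psi> x = 2 * eul \<phi> x + (?m - 4) * \<phi> x - bdf x * a x" for x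
    by (simp add: \<psi>_def A_def field_simps)
  \<comment> \<open>On the sphere \<open>\<psi>4\<close> says that \<open>2 * \<psi>\<close> equals
    \<open>eul \<phi>\<close>, which is exactly what makes the radial derivative of the remainder
    vanish there.\<close>
  have R0: "R x = 0" if x: "x \<in> ball 0 1" for x
  proof (rule degenerate_elliptic_zero[OF U sR _ _ _ x])
    fix y :: 'a assume y: "y \<in> sphere 0 1"
    then have yU: "y \<in> U" using U(2) by auto
    show "R y = 0" using bdry[OF y] bdf_sphere[OF y] by (simp add: R_def)
    show "eul R y = 0" using eulR[OF yU] \<psi>4[of y] bdry[OF y] bdf_sphere[OF y] by simp
  next
    fix y :: 'a assume y: "y \<in> ball 0 1"
    then have yU: "y \<in> U" using sub by auto
    have a: "bdf y * a y = 2 * eul \<phi> y + (?m - 4) * \<phi> y - 4 * \<psi> y" using \<psi>4[of y] by simp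
    have "bdf y * lap R y = 2 * (bdf y * a y) - bdf y * (4 * eul \<psi> y + 2 * ?m * \<psi> y)"
      unfolding lapR[OF y] by (simp add: algebra_simps)
    also have "\<dots> = 2 * (2 * eul R y + (?m - 4) * R y)"
      unfolding a eulR[OF yU] by (simp add: R_def algebra_simps)
    finally show "bdf y * lap R y = 2 * (2 * eul R y + (?m - 4) * R y)" .
  qed
  \<comment> \<open>The remainder vanishes on an open set, hence so does its Laplacian; by
    \<open>lapR\<close> this is the Euler equation for \<open>\<psi>\<close>.\<close>
  have "lap R x = 0" if x: "x \<in> ball 0 1" for x
    using lap_cong[of "ball 0 1" R "\<lambda>x. 0" x] R0 x smooth_on_subset[OF sR sub] by (simp add: lap_const)
  then have "real DIM('a) * \<psi> x + 2 * eul \<psi> x = a x" if "x \<in> ball 0 1" for x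
    using lapR[OF that] that by simp
  moreover have "\<phi> x = bdf x * \<psi> x" if "x \<in> ball 0 1" for x
    using R0[OF that] by (simp add: R_def)
  ultimately show ?thesis using s\<psi> by blast
qed

section \<open>Euler equations along rays\<close>

text \<open>At the point \<open>t *\<^sub>R x\<close> with t > 0 the derivative in direction
  \<open>x\<close> is the Euler derivative divided by t. The mean value theorem supplies such a t
  strictly inside the interval, so the centre causes no division by zero.\<close>

lemma eul_nonpos_le_centre:
  fixes V :: "'a::euclidean_space \<Rightarrow> real"
  assumes V: "smooth_on (ball 0 1) V" and le: "\<And>x. x \<in> ball 0 1 \<Longrightarrow> eul V x \<le> 0"
    and x: "x \<in> ball 0 1"
  shows "V x \<le> V 0"
proof -
  have inb: "0 + t *\<^sub>R x \<in> ball 0 1" if "0 \<le> t" "t \<le> 1" for t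
    using x that mult_le_one[of t "norm x"] mult_right_mono[of t 1 "norm x"] by simp
  obtain t where t: "0 < t" "t < 1"
    "V (0 + 1 *\<^sub>R x) - V (0 + 0 *\<^sub>R x) = (1 - 0) * pd x V (0 + t *\<^sub>R x)"
    using MVT2[of 0 1 "\<lambda>t. V (0 + t *\<^sub>R x)" "\<lambda>t. pd x V (0 + t *\<^sub>R x)"] pd_ray[OF V inb] by auto
  have "eul V (t *\<^sub>R x) = t * pd x V (t *\<^sub>R x)"
    unfolding eul_def using linear_cmul[OF linear_pd[OF V inb[of t]]] t by simp
  then have "t * pd x V (t *\<^sub>R x) \<le> 0" using le[OF inb[of t]] t by simp
  then have "pd x V (t *\<^sub>R x) \<le> 0" using t by (simp add: mult_le_0_iff)
  then show ?thesis using t by simp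
qed

text \<open>The energy \<open>2 * (eul u)\<^sup>2 + c\<^sub>0 * u\<^sup>2\<close> does not increase along rays, and vanishes at the centre.\<close>

lemma euler_ode_second_order_zero:
  fixes u :: "'a::euclidean_space \<Rightarrow> real"
  assumes u: "smooth_on (ball 0 1) u" and c: "c\<^sub>1 \<ge> 0" "c\<^sub>0 > 0"
    and eq: "\<And>x. x \<in> ball 0 1 \<Longrightarrow> 2 * eul (eul u) x + c\<^sub>1 * eul u x + c\<^sub>0 * u x = 0"
    and x: "x \<in> ball 0 1"
  shows "u x = 0"
proof -
  have su: "smooth_on (ball 0 1) (eul u)" by (rule smooth_on_eul[OF open_ball u])
  define V where "V = (\<lambda>x. 2 * (eul u x * eul u x) + c\<^sub>0 * (u x * u x))"
  have V: "smooth_on (ball 0 1) V" unfolding V_def by (intro smooth_intros u su open_ball)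
  have "eul V y \<le> 0" if y: "y \<in> ball 0 1" for y
  proof -
    have "eul V y = 2 * (2 * eul u y * eul (eul u) y) + c\<^sub>0 * (2 * u y * eul u y)"
      unfolding V_def eul_def[of "\<lambda>x. _ x + _ x"]
      by (subst pd_add[of "ball 0 1"], (intro smooth_intros u su open_ball y)+,
          subst pd_cmult[of "ball 0 1"], (intro smooth_intros u su open_ball y)+,
          subst pd_cmult[of "ball 0 1"], (intro smooth_intros u su open_ball y)+,
          simp only: pd_mult[OF u u y] pd_mult[OF su su y]) (simp add: eul_def)
    also have "\<dots> = 2 * eul u y * (2 * eul (eul u) y + c\<^sub>0 * u y)" by (simp add: algebra_simps)
    also have "2 * eul (eul u) y + c\<^sub>0 * u y = - c\<^sub>1 * eul u y" using eq[OF y] by simp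
    also have "2 * eul u y * (- c\<^sub>1 * eul u y) = - 2 * c\<^sub>1 * (eul u y)\<^sup>2"
      by (simp add: power2_eq_square)
    finally show ?thesis using c by simp
  qed
  then have "V x \<le> V 0" by (rule eul_nonpos_le_centre[OF V _ x])
  moreover have "eul u 0 = 0" "eul (eul u) 0 = 0" using eul_0[OF u] eul_0[OF su] by auto
  \<comment> \<open>Every Euler derivative vanishes at the centre, so there the equation reduces to
    \<open>c\<^sub>0 * u 0 = 0\<close>.\<close>
  ultimately have "V x \<le> 0" using eq[of 0] c by (simp add: V_def)
  moreover have "c\<^sub>0 * (u x * u x) \<le> V x" by (simp add: V_def)
  ultimately have "c\<^sub>0 * (u x * u x) \<le> 0" by linarith
  then show ?thesis using c by (simp add: mult_le_0_iff)
      (metis mult_eq_0_iff zero_le_square order_antisym)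
qed

text \<open>Along a ray the nonzero solutions behave like t to the power \<open>-c\<close> and blow
  up at the centre. The square of \<open>u\<close> as energy turns this into a monotonicity
  argument.\<close>

lemma euler_ode_first_order_zero:
  fixes u :: "'a::euclidean_space \<Rightarrow> real"
  assumes u: "smooth_on (ball 0 1) u" and c: "c > 0"
    and eq: "\<And>x. x \<in> ball 0 1 \<Longrightarrow> eul u x + c * u x = 0"
    and x: "x \<in> ball 0 1"
  shows "u x = 0"
proof -
  have V: "smooth_on (ball 0 1) (\<lambda>x. u x * u x)" by (intro smooth_intros u open_ball)
  have "eul (\<lambda>x. u x * u x) y \<le> 0" if y: "y \<in> ball 0 1" for y
  proof -
    have "eul (\<lambda>x. u x * u x) y = 2 * u y * eul u y"
      unfolding eul_def pd_mult[OF u u y] by simp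
    also have "eul u y = - c * u y" using eq[OF y] by simp
    also have "2 * u y * (- c * u y) = - 2 * c * (u y)\<^sup>2" by (simp add: power2_eq_square)
    finally show ?thesis using c by simp
  qed
  then have "u x * u x \<le> u 0 * u 0" by (rule eul_nonpos_le_centre[OF V _ x])
  moreover have "u 0 = 0" using eq[of 0] eul_0[OF u] c by simp
  ultimately show ?thesis by (metis mult_eq_0_iff zero_le_square order_antisym)
qed

lemma pd_zero_imp_const:
  fixes u :: "'a::euclidean_space \<Rightarrow> real"
  assumes u: "smooth_on (ball 0 1) u" and eq: "\<And>v x. x \<in> ball 0 1 \<Longrightarrow> pd v u x = 0"
    and x: "x \<in> ball 0 1"
  shows "u x = u 0"
proof -
  have "smooth_on (ball 0 1) (\<lambda>x. - u x)" by (intro smooth_intros u open_ball)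
  moreover have "eul (\<lambda>x. - u x) y \<le> 0" if "y \<in> ball 0 1" for y
    unfolding eul_def using pd_uminus[OF u that] eq that by simp
  ultimately have "- u x \<le> - u 0" using eul_nonpos_le_centre x by blast
  moreover have "u x \<le> u 0" using eul_nonpos_le_centre[OF u _ x] eq by (simp add: eul_def)
  ultimately show ?thesis by simp
qed

section \<open>Alternating forms\<close>

abbreviation omit :: "nat \<Rightarrow> 'a list \<Rightarrow> 'a list" where
  "omit i vs \<equiv> take i vs @ drop (Suc i) vs"

lemma length_omit: "i < length vs \<Longrightarrow> length (omit i vs) = length vs - 1"
  by auto

lemma nth_omit: "i < length vs \<Longrightarrow> k < length vs - 1 \<Longrightarrow> omit i vs ! k = vs ! (if k < i then k else Suc k)"
  by (auto simp: nth_append min_def)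

lemma omit_update_same: "omit i (vs[i := v]) = omit i vs"
  by simp

lemma omit_update:
  "i \<noteq> j \<Longrightarrow> i < length vs \<Longrightarrow> j < length vs
   \<Longrightarrow> omit i (vs[j := v]) = (omit i vs)[(if j < i then j else j - 1) := v]"
  by (rule nth_equalityI) (auto simp: nth_omit nth_list_update length_omit nth_append min_def)

text \<open>In the last two parts the lists have any length: on a wrong length \<open>f\<close> is
  zero, so later rewriting needs no length side conditions.\<close>

lemma alternating_formD:
  assumes "alternating_form p f"
  shows "length vs \<noteq> p \<Longrightarrow> f vs = 0"
    and "i < length vs \<Longrightarrow> j < length vs \<Longrightarrow> i \<noteq> j \<Longrightarrow> vs ! i = vs ! j \<Longrightarrow> f vs = 0"
    and "linear (\<lambda>v. f (As @ v # Cs))"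
    and "f (As @ v # Bs @ v # Cs) = 0"
proof -
  show 1: "f vs = 0" if "length vs \<noteq> p" for vs using that assms by (auto simp: alternating_form_def)
  show 2: "f vs = 0" if "i < length vs" "j < length vs" "i \<noteq> j" "vs ! i = vs ! j" for i j vs
  proof (cases "length vs = p")
    case True
    have "f vs = 0" if "i < j" "j < p" "vs ! i = vs ! j" for i j
      using assms that True unfolding alternating_form_def by blast
    then show ?thesis using that True by (metis linorder_neqE_nat)
  qed (use 1 in auto)
  show "f (As @ v # Bs @ v # Cs) = 0"
    by (rule 2[of "length As" _ "Suc (length As + length Bs)"])
       (auto simp: nth_append)
  show "linear (\<lambda>v. f (As @ v # Cs))"
  proof (cases "length (As @ undefined # Cs) = p")
    case True
    then have "linear (\<lambda>v. f ((As @ undefined # Cs)[length As := v]))"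
      using assms unfolding alternating_form_def
      by (metis add_Suc_right length_Cons length_append less_add_Suc1)
    then show ?thesis by simp
  next
    case False
    then have "f (As @ v # Cs) = 0" for v using 1[of "As @ v # Cs"] by simp
    then show ?thesis by (simp add: linear_zero)
  qed
qed

lemma alternating_form_head:
  assumes "alternating_form p f"
  shows "linear (\<lambda>v. f (v # vs))" "f (v # As @ v # Bs) = 0"
  using alternating_formD(3)[OF assms, of "[]"] alternating_formD(4)[OF assms, of "[]"] by auto

lemma alternating_form_swap:
  assumes "alternating_form p f"
  shows "f (As @ u # v # Cs) = - f (As @ v # u # Cs)"
proof -
  have l1: "linear (\<lambda>x. f (As @ x # y # Cs))" for y using alternating_formD(3)[OF assms] .
  have l2: "linear (\<lambda>y. f (As @ x # y # Cs))" for x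
    using alternating_formD(3)[OF assms, of "As @ [x]"] by simp
  have z: "f (As @ x # x # Cs) = 0" for x using alternating_formD(4)[OF assms, of As x "[]"] by simp
  have "f (As @ (u + v) # (u + v) # Cs) = 0" by (rule z)
  then have "f (As @ u # v # Cs) + f (As @ v # u # Cs) = 0"
    by (simp add: linear_add[OF l1] linear_add[OF l2] z[of u] z[of v])
  then show ?thesis by linarith
qed

lemma alternating_form_move:
  assumes "alternating_form p f"
  shows "f (As @ v # Bs @ Cs) = (-1) ^ length Bs * f (As @ Bs @ v # Cs)"
proof (induction Bs arbitrary: As)
  case (Cons b Bs)
  have "f (As @ v # b # Bs @ Cs) = - f ((As @ [b]) @ v # Bs @ Cs)"
    using alternating_form_swap[OF assms, of As v b "Bs @ Cs"] by simp
  also have "\<dots> = - ((-1) ^ length Bs * f ((As @ [b]) @ Bs @ v # Cs))" by (simp only: Cons)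
  finally show ?case by simp
qed simp

lemma alternating_form_nth_omit:
  assumes "alternating_form p f" "i < length vs"
  shows "f (vs ! i # omit i vs) = (-1) ^ i * f vs"
  using alternating_form_move[OF assms(1), of "[]" "vs ! i" "take i vs" "drop (Suc i) vs"] assms(2)
  by (simp add: id_take_nth_drop[symmetric] min_def)

lemma alternating_form_contract:
  assumes "alternating_form (Suc p) f" shows "alternating_form p (\<lambda>vs. f (x # vs))"
  unfolding alternating_form_def
proof (intro conjI allI impI)
  fix vs :: "'a list" and i
  assume "length vs = p \<and> i < p"
  then show "linear (\<lambda>v. f (x # vs[i := v]))"
    using alternating_formD(3)[OF assms, of "x # take i vs" "drop (Suc i) vs"]
    by (simp add: upd_conv_take_nth_drop)
next
  fix vs :: "'a list" and i j
  assume "length vs = p \<and> i < j \<and> j < p \<and> vs ! i = vs ! j"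
  then show "f (x # vs) = 0"
    using alternating_formD(2)[OF assms, of "Suc i" "x # vs" "Suc j"] by simp
qed (use alternating_formD(1)[OF assms] in auto)

text \<open>Common shape of several operations: with directional derivatives as \<open>F\<close> it
  is the exterior derivative, with a covector applied to \<open>w\<close> times a form it is the
  wedge product with that covector, and with \<open>F w l = f (w # l)\<close> it multiplies a form
  by its degree.\<close>

definition alt_sum :: "('a \<Rightarrow> 'a list \<Rightarrow> real) \<Rightarrow> 'a list \<Rightarrow> real" where
  "alt_sum F vs = (\<Sum>i<length vs. (-1) ^ i * F (vs ! i) (omit i vs))"

text \<open>The remaining indices shift by one and change sign. This is the antiderivation rule for
  contraction with \<open>x\<close>.\<close>

lemma alt_sum_Cons: "alt_sum F (x # vs) = F x vs - alt_sum (\<lambda>w l. F w (x # l)) vs"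
  by (simp add: alt_sum_def sum.lessThan_Suc_shift sum_negf del: sum.lessThan_Suc)

text \<open>Moving entry i to the front produces the same sign that the sum carries, so all
  \<open>p\<close> terms are equal.\<close>

lemma alt_sum_contract:
  assumes "alternating_form p f" "length vs = p"
  shows "alt_sum (\<lambda>w l. f (w # l)) vs = real p * f vs"
proof -
  have "alt_sum (\<lambda>w l. f (w # l)) vs = (\<Sum>i<length vs. f vs)"
    unfolding alt_sum_def
    by (intro sum.cong refl) (simp add: alternating_form_nth_omit[OF assms(1)] flip: power_mult_distrib mult.assoc)
  then show ?thesis using assms(2) by simp
qed

text \<open>If entries i and j agree, every term that keeps both vanishes. The two that remain
  differ by moving one entry across those strictly between i and j, and cancel.\<close>

lemma alternating_form_alt_sum:
  assumes F: "\<And>w. alternating_form p (F w)" and lin: "\<And>vs. linear (\<lambda>w. F w vs)"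
  shows "alternating_form (Suc p) (alt_sum F)"
  unfolding alternating_form_def
proof (intro conjI allI impI)
  fix vs :: "'a list" assume "length vs \<noteq> Suc p"
  then have "F (vs ! i) (omit i vs) = 0" if "i < length vs" for i
    using alternating_formD(1)[OF F] length_omit[OF that] that by simp
  then show "alt_sum F vs = 0" by (simp add: alt_sum_def)
next
  fix vs :: "'a list" and j assume vs: "length vs = Suc p \<and> j < Suc p"
  have "linear (\<lambda>v. F (vs[j := v] ! i) (omit i (vs[j := v])))" if i: "i < length vs" for i
  proof (cases "i = j")
    case True
    then show ?thesis using lin i by (simp add: omit_update_same)
  next
    case False
    have j: "(if j < i then j else j - 1) < p" using vs i False by auto
    show ?thesis
      using F[of "vs ! i", unfolded alternating_form_def] length_omit[OF i] vs j
      unfolding omit_update[OF False i conjunct2[OF vs, folded conjunct1[OF vs]]]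
      using False by (simp del: length_append)
  qed
  then have "linear (\<lambda>v. (-1) ^ i * F (vs[j := v] ! i) (omit i (vs[j := v])))" if "i < length vs" for i
    using linear_compose_scale_right[of "\<lambda>v. F (vs[j := v] ! i) (omit i (vs[j := v]))" "(-1) ^ i"] that
    by simp
  then show "linear (\<lambda>v. alt_sum F (vs[j := v]))"
    unfolding alt_sum_def length_list_update by (intro linear_compose_sum) auto
next
  fix vs :: "'a list" and i j
  assume vs: "length vs = Suc p \<and> i < j \<and> j < Suc p \<and> vs ! i = vs ! j"
  let ?t = "\<lambda>k. (-1) ^ k * F (vs ! k) (omit k vs)"
  have "?t k = 0" if k: "k < length vs" "k \<noteq> i" "k \<noteq> j" for k
  proof -
    let ?i = "if i < k then i else i - 1" and ?j = "if j < k then j else j - 1"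
    have b: "?i < length vs - 1" "?j < length vs - 1" "?i \<noteq> ?j" using k vs by auto
    have "omit k vs ! ?i = omit k vs ! ?j"
      unfolding nth_omit[OF k(1) b(1)] nth_omit[OF k(1) b(2)] using k vs by auto
    then have "F (vs ! k) (omit k vs) = 0"
      using alternating_formD(2)[OF F, of ?i "omit k vs" ?j "vs ! k"] b length_omit[OF k(1)] by simp
    then show ?thesis by simp
  qed
  then have "alt_sum F vs = (\<Sum>k\<in>{i, j}. ?t k)"
    unfolding alt_sum_def by (intro sum.mono_neutral_right) (use vs in auto)
  also have "\<dots> = ?t i + ?t j" using vs by simp
  also have "\<dots> = 0"
  proof -
    define As v Bs Cs where "As = take i vs" and "v = vs ! i"
      and "Bs = take (j - Suc i) (drop (Suc i) vs)" and "Cs = drop (Suc j) vs"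
    have "vs = take i vs @ v # drop (Suc i) vs"
      unfolding v_def by (rule id_take_nth_drop) (use vs in auto)
    moreover have "drop (Suc i) vs = Bs @ v # Cs"
    proof -
      have "j - Suc i < length (drop (Suc i) vs)" using vs by auto
      from id_take_nth_drop[OF this] show ?thesis using vs by (simp add: Bs_def Cs_def v_def)
    qed
    ultimately have dec: "vs = As @ v # Bs @ v # Cs" by (simp add: As_def)
    have l: "length As = i" "length Bs = j - Suc i" using vs by (auto simp: As_def Bs_def)
    have "omit i vs = As @ Bs @ v # Cs" by (subst (1 2) dec) (simp add: l(1)[symmetric])
    \<comment> \<open>The signs differ by one more than the number of transpositions of the move,
      hence the cancellation.\<close>
    moreover have j: "j = Suc (length As + length Bs)" using vs l by simp
    have "omit j vs = As @ v # Bs @ Cs" unfolding j by (subst (1 2) dec) simp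
    ultimately have "?t i + ?t j = (-1) ^ i * F v (As @ Bs @ v # Cs) + (-1) ^ j * F v (As @ v # Bs @ Cs)"
      using vs by (simp add: v_def)
    then show ?thesis
      unfolding alternating_form_move[OF F, of v As v Bs Cs] j l(1)[symmetric]
      by (simp add: power_add flip: power_mult_distrib mult.assoc)
  qed
  finally show "alt_sum F vs = 0" .
qed

lemma linear_cmult: "linear g \<Longrightarrow> linear (\<lambda>x. c * g x :: real)"
  using linear_compose_scale_right[of g c] by simp

lemma alternating_form_scale:
  assumes "alternating_form p f" shows "alternating_form p (\<lambda>vs. c * f vs)"
  using assms unfolding alternating_form_def
  by (auto intro: linear_cmult)

lemma alternating_form_diff:
  assumes "alternating_form p f" "alternating_form p g" shows "alternating_form p (\<lambda>vs. f vs - g vs)"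
  using assms unfolding alternating_form_def by (auto intro: linear_compose_sub)

text \<open>The wedge product of the covectors dual to \<open>bs\<close>, built one factor at a
  time; orthonormality kills every term on \<open>bs\<close> except the first. It provides the
  constant forms from which eigenforms are made.\<close>

lemma exists_alternating_form:
  fixes bs :: "'a::euclidean_space list"
  assumes "distinct bs" "set bs \<subseteq> Basis"
  shows "\<exists>c. alternating_form (length bs) c \<and> c bs = 1"
  using assms
proof (induction bs)
  case Nil
  show ?case
    by (rule exI[of _ "\<lambda>vs. if vs = [] then 1 else 0"]) (auto simp: alternating_form_def)
next
  case (Cons b bs)
  then obtain c where c: "alternating_form (length bs) c" "c bs = 1" by auto
  have "alternating_form (Suc (length bs)) (alt_sum (\<lambda>w l. (w \<bullet> b) * c l))"
  proof (rule alternating_form_alt_sum)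
    show "linear (\<lambda>w. (w \<bullet> b) * c l)" for l
      using linear_compose_scale_right[OF linear_inner_left[of b], of "c l"] by (simp add: mult.commute)
  qed (rule alternating_form_scale[OF c(1)])
  moreover have "alt_sum (\<lambda>w l. (w \<bullet> b) * c (b # l)) bs = 0"
    unfolding alt_sum_def
  proof (intro sum.neutral ballI)
    fix i assume "i \<in> {..<length bs}"
    then have "bs ! i \<in> Basis" "bs ! i \<noteq> b" using Cons.prems by auto
    then have "(bs ! i) \<bullet> b = 0" using Cons.prems by (auto simp: inner_not_same_Basis)
    then show "(-1) ^ i * ((bs ! i \<bullet> b) * c (b # omit i bs)) = 0" by simp
  qed
  then have "alt_sum (\<lambda>w l. (w \<bullet> b) * c l) (b # bs) = 1"
    using Cons.prems c(2) by (simp add: alt_sum_Cons)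
  ultimately show ?case by auto
qed

lemma alternating_form_zero_if_tangential:
  fixes x :: "'a::euclidean_space"
  assumes f: "alternating_form p f" and x: "norm x = 1" and normal: "\<And>vs. f (x # vs) = 0"
    and tang: "\<And>vs. set vs \<subseteq> tangent_space x \<Longrightarrow> f vs = 0"
  shows "f vs = 0"
proof -
  \<comment> \<open>The prefix \<open>ws\<close> collects the entries already replaced by their
    tangential parts.\<close>
  have "f (ws @ vs) = 0" if "set ws \<subseteq> tangent_space x" for ws
    using that
  proof (induction vs arbitrary: ws)
    case Nil
    then show ?case using tang by simp
  next
    case (Cons v vs)
    define u where "u = v - (v \<bullet> x) *\<^sub>R x"
    have "u \<in> tangent_space x"
      using x by (simp add: u_def tangent_space_def inner_normal_def inner_diff_left dot_square_norm)
    then have u: "f (ws @ u # vs) = 0" using Cons.IH[of "ws @ [u]"] Cons.prems by simp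
    have "f (x # ws @ vs) = (-1) ^ length ws * f (ws @ x # vs)"
      using alternating_form_move[OF f, of "[]" x ws vs] by simp
    then have xx: "f (ws @ x # vs) = 0" using normal by simp
    have lin: "linear (\<lambda>v. f (ws @ v # vs))" by (rule alternating_formD(3)[OF f])
    have "v = u + (v \<bullet> x) *\<^sub>R x" by (simp add: u_def)
    then have "f (ws @ v # vs) = f (ws @ u # vs) + (v \<bullet> x) * f (ws @ x # vs)"
      using linear_add[OF lin] linear_cmul[OF lin] by (metis real_scaleR_def)
    then show ?case using u xx by simp
  qed
  from this[of "[]"] show ?thesis by simp
qed

section \<open>Exterior derivative and codifferential on the closed ball\<close>

text \<open>By convexity the segment from \<open>x\<close> to any \<open>y\<close> of the ball stays
  inside, so one-sided derivatives determine both maps on all differences \<open>y - x\<close>, also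
  at boundary points; these differences span the space.\<close>

lemma has_derivative_within_cball_unique:
  fixes g :: "'a::euclidean_space \<Rightarrow> real"
  assumes D: "(g has_derivative D1) (at x within cball 0 1)" "(g has_derivative D2) (at x within cball 0 1)"
    and x: "x \<in> cball 0 1"
  shows "D1 = D2"
proof -
  have eq: "D1 (y - x) = D2 (y - x)" if y: "y \<in> cball 0 1" for y
  proof -
    let ?c = "\<lambda>t::real. x + t *\<^sub>R (y - x)"
    have sub: "?c ` {0..1} \<subseteq> cball 0 1"
    proof
      fix z assume "z \<in> ?c ` {0..1}"
      then obtain t where t: "0 \<le> t" "t \<le> 1" "z = (1 - t) *\<^sub>R x + t *\<^sub>R y" by (auto simp: algebra_simps)
      then show "z \<in> cball 0 1" using convexD_alt[OF convex_cball x y, of t] by simp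
    qed
    have "((\<lambda>t. g (?c t)) has_vector_derivative D (y - x)) (at 0 within {0..1})"
      if D: "(g has_derivative D) (at x within cball 0 1)" for D
    proof -
      have "(g has_derivative D) (at (?c 0) within ?c ` {0..1})"
        using has_derivative_subset[OF D sub] by simp
      moreover have "(?c has_derivative (\<lambda>t. t *\<^sub>R (y - x))) (at 0 within {0..1})"
        by (auto intro!: derivative_eq_intros)
      ultimately have "((\<lambda>t. g (?c t)) has_derivative (\<lambda>t. D (t *\<^sub>R (y - x)))) (at 0 within {0..1})"
        by (rule has_derivative_in_compose[rotated])
      then show ?thesis
        using linear_cmul[OF has_derivative_linear[OF D]] by (simp add: has_vector_derivative_def)
    qed
    from this[OF D(1)] this[OF D(2)] show ?thesis
      using vector_derivative_unique_within_closed_interval[of 0 1 0 "\<lambda>t. g (?c t)"]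
      by (simp add: cbox_interval)
  qed
  have L: "linear (\<lambda>v. D1 v - D2 v)"
    using D by (intro linear_compose_sub has_derivative_linear)
  \<comment> \<open>The centre as \<open>y\<close> gives agreement at \<open>-x\<close>, hence at
    \<open>x\<close>; adding \<open>x\<close> back extends the agreement from differences to the
    ball itself.\<close>
  have "D1 x = D2 x"
    using eq[of 0] linear_neg[OF L, of x] by simp
  then have ball: "D1 y - D2 y = 0" if "y \<in> cball 0 1" for y
    using eq[OF that] linear_diff[OF L, of y x] by simp
  have "D1 v - D2 v = 0" for v
  proof -
    have "v = norm v *\<^sub>R (v /\<^sub>R norm v)" by (cases "v = 0") auto
    moreover have "norm (v /\<^sub>R norm v) \<le> 1" by (cases "v = 0") auto
    ultimately show ?thesis using linear_cmul[OF L, of "norm v" "v /\<^sub>R norm v"] ball[of "v /\<^sub>R norm v"] by simp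
  qed
  then show ?thesis by (intro ext) simp
qed

text \<open>The bridge from derivatives within the closed ball to two-sided derivatives of any
  smooth extension; it lets the analysis work on open sets.\<close>

lemma frechet_derivative_within_cball:
  assumes "cball 0 1 \<subseteq> U" "smooth_on U b" "\<And>y. y \<in> cball 0 1 \<Longrightarrow> g y = b y" "x \<in> cball 0 1"
  shows "frechet_derivative g (at x within cball 0 1) v = pd v b x"
proof -
  have "(b has_derivative (\<lambda>v. pd v b x)) (at x within cball 0 1)"
    using smooth_on_has_derivative[OF assms(2)] assms(1,4) has_derivative_at_withinI by blast
  then have D: "(g has_derivative (\<lambda>v. pd v b x)) (at x within cball 0 1)"
    by (rule has_derivative_transform_within[OF _ zero_less_one assms(4)]) (simp add: assms(3))
  then have "(g has_derivative frechet_derivative g (at x within cball 0 1)) (at x within cball 0 1)"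
    by (metis differentiableI frechet_derivative_works)
  from has_derivative_within_cball_unique[OF this D assms(4)] show ?thesis by simp
qed

lemma smooth_form_onD:
  assumes "smooth_form_on p U \<beta>"
  shows "x \<in> U \<Longrightarrow> alternating_form p (\<beta> x)" "smooth_on U (\<lambda>x. \<beta> x vs)"
  using assms by (auto simp: smooth_form_on_def)

lemma smooth_form_on_pd:
  assumes U: "open U" and \<beta>: "smooth_form_on p U \<beta>"
  shows "smooth_form_on p U (\<lambda>x vs. pd w (\<lambda>y. \<beta> y vs) x)"
  unfolding smooth_form_on_def alternating_form_def
proof (intro conjI ballI allI impI)
  note alt = smooth_form_onD(1)[OF \<beta>] and sm = smooth_form_onD(2)[OF \<beta>]
  show "smooth_on U (\<lambda>x. pd w (\<lambda>y. \<beta> y vs) x)" for vs using smooth_on_pd[OF sm] .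
  fix x assume x: "x \<in> U"
  have zero: "pd w (\<lambda>y. \<beta> y vs) x = 0" if "\<And>y. y \<in> U \<Longrightarrow> \<beta> y vs = 0" for vs
    using pd_cong[OF U that sm x] by (simp add: pd_const)
  show "pd w (\<lambda>y. \<beta> y vs) x = 0" if "length vs \<noteq> p" for vs
    using zero alternating_formD(1)[OF alt that] .
  show "pd w (\<lambda>y. \<beta> y vs) x = 0" if "length vs = p \<and> i < j \<and> j < p \<and> vs ! i = vs ! j" for vs i j
    by (rule zero, rule alternating_formD(2)[OF alt, of _ i _ j]) (use that in auto)
  show "linear (\<lambda>v. pd w (\<lambda>y. \<beta> y (vs[i := v])) x)" if "length vs = p \<and> i < p" for vs i
  proof (rule linearI)
    have lin: "linear (\<lambda>v. \<beta> y (vs[i := v]))" if "y \<in> U" for y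
      using alt[OF that] \<open>length vs = p \<and> i < p\<close> unfolding alternating_form_def by blast
    show "pd w (\<lambda>y. \<beta> y (vs[i := a + b])) x
        = pd w (\<lambda>y. \<beta> y (vs[i := a])) x + pd w (\<lambda>y. \<beta> y (vs[i := b])) x" for a b
      by (subst pd_add[OF sm sm x, symmetric], rule pd_cong[OF U _ sm x]) (rule linear_add[OF lin])
    show "pd w (\<lambda>y. \<beta> y (vs[i := r *\<^sub>R a])) x = r *\<^sub>R pd w (\<lambda>y. \<beta> y (vs[i := a])) x" for r a
      unfolding real_scaleR_def
      by (subst pd_cmult[OF sm x, symmetric], rule pd_cong[OF U _ sm x])
         (use linear_cmul[OF lin] in auto)
  qed
qed

section \<open>Exterior derivative and divergence on open sets\<close>

definition dform :: "'a::euclidean_space form \<Rightarrow> 'a form" where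
  "dform \<beta> x = alt_sum (\<lambda>w l. pd w (\<lambda>y. \<beta> y l) x)"

text \<open>The codifferential with opposite sign.\<close>

definition divform :: "'a::euclidean_space form \<Rightarrow> 'a form" where
  "divform \<beta> x vs = (\<Sum>e\<in>Basis. pd e (\<lambda>y. \<beta> y (e # vs)) x)"

lemma smooth_on_dform:
  assumes "open U" "\<And>vs. smooth_on U (\<lambda>x. \<beta> x vs)" shows "smooth_on U (\<lambda>x. dform \<beta> x vs)"
  unfolding dform_def alt_sum_def by (intro smooth_intros assms)

lemma smooth_on_divform:
  assumes "open U" "\<And>vs. smooth_on U (\<lambda>x. \<beta> x vs)" shows "smooth_on U (\<lambda>x. divform \<beta> x vs)"
  unfolding divform_def by (intro smooth_intros assms)

lemma smooth_form_on_dform: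
  assumes U: "open U" and \<beta>: "smooth_form_on p U \<beta>"
  shows "smooth_form_on (Suc p) U (dform \<beta>)"
  unfolding smooth_form_on_def
proof (intro conjI ballI allI)
  fix x assume x: "x \<in> U"
  show "alternating_form (Suc p) (dform \<beta> x)"
    unfolding dform_def
    by (rule alternating_form_alt_sum)
       (rule smooth_form_onD(1)[OF smooth_form_on_pd[OF U \<beta>] x] linear_pd[OF smooth_form_onD(2)[OF \<beta>] x])+
qed (rule smooth_on_dform[OF U smooth_form_onD(2)[OF \<beta>]])

lemma exterior_derivative_eq_dform:
  assumes "cball 0 1 \<subseteq> U" "\<And>vs. smooth_on U (\<lambda>x. \<beta> x vs)"
    "\<And>y vs. y \<in> cball 0 1 \<Longrightarrow> \<eta> y vs = \<beta> y vs" "x \<in> cball 0 1"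
  shows "exterior_derivative (cball 0 1) \<eta> x vs = dform \<beta> x vs"
  unfolding exterior_derivative_def dform_def alt_sum_def if_P[OF assms(4)]
  by (intro sum.cong refl arg_cong2[where f = "(*)"] frechet_derivative_within_cball[OF assms(1,2) _ assms(4)] assms(3))

lemma codifferential_eq_divform:
  assumes "cball 0 1 \<subseteq> U" "\<And>vs. smooth_on U (\<lambda>x. \<beta> x vs)"
    "\<And>y vs. y \<in> cball 0 1 \<Longrightarrow> \<eta> y vs = \<beta> y vs" "x \<in> cball 0 1"
  shows "codifferential (cball 0 1) \<eta> x vs = - divform \<beta> x vs"
  unfolding codifferential_def divform_def if_P[OF assms(4)]
  by (intro sum.cong refl arg_cong[where f = uminus] frechet_derivative_within_cball[OF assms(1,2) _ assms(4)] assms(3))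

text \<open>The flat Weitzenboeck formula: when the entry \<open>e\<close> is itself the direction
  of differentiation the second derivatives add up to the Laplacian; in all other terms the
  derivatives commute.\<close>

lemma divform_dform:
  assumes U: "open U" "\<And>vs. smooth_on U (\<lambda>x. \<beta> x vs)" and x: "x \<in> U"
  shows "divform (dform \<beta>) x vs = lap (\<lambda>y. \<beta> y vs) x - dform (divform \<beta>) x vs"
proof -
  have "pd e (\<lambda>y. dform \<beta> y (e # vs)) x = pd e (pd e (\<lambda>y. \<beta> y vs)) x
      - (\<Sum>i<length vs. (-1) ^ i * pd (vs ! i) (pd e (\<lambda>y. \<beta> y (e # omit i vs))) x)" for e
  proof -
    have "pd e (\<lambda>y. dform \<beta> y (e # vs)) x = pd e (\<lambda>y. pd e (\<lambda>y. \<beta> y vs) y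
      - (\<Sum>i<length vs. (-1) ^ i * pd (vs ! i) (\<lambda>y. \<beta> y (e # omit i vs)) y)) x"
      unfolding dform_def alt_sum_Cons by (simp add: alt_sum_def)
    also have "\<dots> = pd e (pd e (\<lambda>y. \<beta> y vs)) x
      - (\<Sum>i<length vs. (-1) ^ i * pd e (pd (vs ! i) (\<lambda>y. \<beta> y (e # omit i vs))) x)"
      by (subst pd_diff[of U], (intro smooth_intros U x)+, subst pd_sum[of _ U],
          (intro smooth_intros U x)+, subst pd_cmult[of U], (intro smooth_intros U x)+, rule refl)
    finally show ?thesis by (simp only: pd_commute[OF U(2,1) x, of e "vs ! i" for i])
  qed
  then have "divform (dform \<beta>) x vs = lap (\<lambda>y. \<beta> y vs) x
      - (\<Sum>e\<in>Basis. \<Sum>i<length vs. (-1) ^ i * pd (vs ! i) (pd e (\<lambda>y. \<beta> y (e # omit i vs))) x)"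
    by (simp add: divform_def[of "dform \<beta>"] lap_def sum_subtractf)
  also have "(\<Sum>e\<in>Basis. \<Sum>i<length vs. (-1) ^ i * pd (vs ! i) (pd e (\<lambda>y. \<beta> y (e # omit i vs))) x)
     = (\<Sum>i<length vs. (-1) ^ i * (\<Sum>e\<in>Basis. pd (vs ! i) (pd e (\<lambda>y. \<beta> y (e # omit i vs))) x))"
    unfolding sum_distrib_left by (rule sum.swap)
  also have "\<dots> = dform (divform \<beta>) x vs"
    unfolding dform_def alt_sum_def divform_def
    by (subst pd_sum[of _ U], (intro smooth_intros U x)+, rule refl)
  finally show ?thesis .
qed

lemma hodge_laplacian_eq_lap:
  assumes U: "open U" "cball 0 1 \<subseteq> U" and \<beta>: "\<And>vs. smooth_on U (\<lambda>x. \<beta> x vs)"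
    and eq: "\<And>y vs. y \<in> cball 0 1 \<Longrightarrow> \<eta> y vs = \<beta> y vs" and x: "x \<in> cball 0 1"
  shows "hodge_laplacian (cball 0 1) \<eta> x vs = - lap (\<lambda>y. \<beta> y vs) x"
proof -
  have xU: "x \<in> U" using x U by auto
  have s: "smooth_on U (\<lambda>x. - divform \<beta> x vs)" for vs
    by (intro smooth_intros smooth_on_divform U \<beta>)
  have "exterior_derivative (cball 0 1) (codifferential (cball 0 1) \<eta>) x vs
      = dform (\<lambda>x vs. - divform \<beta> x vs) x vs"
    by (rule exterior_derivative_eq_dform[OF U(2) s codifferential_eq_divform[OF U(2) \<beta> eq] x])
  also have "\<dots> = - dform (divform \<beta>) x vs"
    unfolding dform_def alt_sum_def
    by (simp add: pd_uminus[OF smooth_on_divform[OF U(1) \<beta>] xU] sum_negf)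
  moreover have "codifferential (cball 0 1) (exterior_derivative (cball 0 1) \<eta>) x vs
      = - divform (dform \<beta>) x vs"
    by (rule codifferential_eq_divform[OF U(2) smooth_on_dform[OF U(1) \<beta>]
          exterior_derivative_eq_dform[OF U(2) \<beta> eq] x])
  ultimately show ?thesis
    unfolding hodge_laplacian_def add_form_def divform_dform[OF U(1) \<beta> xU] by simp
qed

section \<open>The lower bound for the eigenvalues\<close>

lemma contraction_eq_sum:
  fixes \<xi> :: "'a::euclidean_space form"
  assumes "\<And>l. linear (\<lambda>v. \<xi> y (v # l))"
  shows "\<xi> y (v # l) = (\<Sum>e\<in>Basis. (v \<bullet> e) * \<xi> y (e # l))"
  by (rule linear_eq_sum_Basis[OF assms])

text \<open>The point occurs both as base point and as first entry. Expanding that entry in the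
  basis gives a finite sum of products; the product rule then separates the derivative with frozen
  entry from the derivative of the entry, and the divergence arises as the cross term of the
  Laplacian. Asking only for linearity in the first entry allows one lemma to serve several
  families.\<close>

lemma contraction:
  fixes \<xi> :: "'a::euclidean_space form"
  assumes S: "open S" and sm: "\<And>l. smooth_on S (\<lambda>x. \<xi> x l)"
    and lin: "\<And>x l. x \<in> S \<Longrightarrow> linear (\<lambda>v. \<xi> x (v # l))"
  shows smooth_on_contraction: "smooth_on S (\<lambda>y. \<xi> y (y # l))"
    and pd_contraction: "x \<in> S \<Longrightarrow>
      pd w (\<lambda>y. \<xi> y (y # l)) x = pd w (\<lambda>y. \<xi> y (x # l)) x + \<xi> x (w # l)"
    and eul_contraction: "x \<in> S \<Longrightarrow>
      eul (\<lambda>y. \<xi> y (y # l)) x = eul (\<lambda>y. \<xi> y (x # l)) x + \<xi> x (x # l)"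
    and lap_contraction: "x \<in> S \<Longrightarrow> (\<And>l. lap (\<lambda>y. \<xi> y l) x = 0) \<Longrightarrow>
      lap (\<lambda>y. \<xi> y (y # l)) x = 2 * divform \<xi> x l"
proof -
  let ?s = "\<lambda>y. \<Sum>e\<in>Basis. (y \<bullet> e) * \<xi> y (e # l)"
  have ss: "smooth_on S ?s" by (intro smooth_intros S sm)
  have eq: "?s y = \<xi> y (y # l)" if "y \<in> S" for y
    using contraction_eq_sum[where \<xi> = \<xi>, OF lin[OF that]] by metis
  show smc: "smooth_on S (\<lambda>y. \<xi> y (y # l))" by (rule smooth_on_cong[OF S eq ss])
  show pdc: "pd w (\<lambda>y. \<xi> y (y # l)) x = pd w (\<lambda>y. \<xi> y (x # l)) x + \<xi> x (w # l)"
    if x: "x \<in> S" for w x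
  proof -
    have "pd w (\<lambda>y. \<xi> y (y # l)) x = pd w ?s x" by (rule pd_cong[OF S eq[symmetric] smc x])
    also have "\<dots> = (\<Sum>e\<in>Basis. (x \<bullet> e) * pd w (\<lambda>y. \<xi> y (e # l)) x + (w \<bullet> e) * \<xi> x (e # l))"
      by (subst pd_sum[of _ S], (intro smooth_intros S sm x)+)
         (simp add: pd_mult[OF smooth_on_inner sm x] pd_inner)
    also have "\<dots> = (\<Sum>e\<in>Basis. (x \<bullet> e) * pd w (\<lambda>y. \<xi> y (e # l)) x) + \<xi> x (w # l)"
      using contraction_eq_sum[where \<xi> = \<xi>, OF lin[OF x], of w l] by (simp add: sum.distrib)
    also have "(\<Sum>e\<in>Basis. (x \<bullet> e) * pd w (\<lambda>y. \<xi> y (e # l)) x)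
        = pd w (\<lambda>y. \<Sum>e\<in>Basis. (x \<bullet> e) * \<xi> y (e # l)) x"
      by (subst pd_sum[of _ S], (intro smooth_intros S sm x)+) (simp add: pd_cmult[OF sm x])
    also have "\<dots> = pd w (\<lambda>y. \<xi> y (x # l)) x"
    proof (rule pd_cong[OF S _ _ x])
      show "(\<Sum>e\<in>Basis. (x \<bullet> e) * \<xi> y (e # l)) = \<xi> y (x # l)" if "y \<in> S" for y
        using contraction_eq_sum[where \<xi> = \<xi>, OF lin[OF that], of x l] by simp
    qed (intro smooth_intros S sm)
    finally show ?thesis .
  qed
  show "eul (\<lambda>y. \<xi> y (y # l)) x = eul (\<lambda>y. \<xi> y (x # l)) x + \<xi> x (x # l)" if "x \<in> S"
    unfolding eul_def by (rule pdc[OF that])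
  show "lap (\<lambda>y. \<xi> y (y # l)) x = 2 * divform \<xi> x l"
    if x: "x \<in> S" and harm: "\<And>l. lap (\<lambda>y. \<xi> y l) x = 0"
  proof -
    have "lap (\<lambda>y. \<xi> y (y # l)) x = lap ?s x" by (rule lap_cong[OF S eq[symmetric] smc x])
    also have "\<dots> = (\<Sum>e\<in>Basis. lap (\<lambda>y. (y \<bullet> e) * \<xi> y (e # l)) x)"
      by (rule lap_sum[OF S _ x]) (intro smooth_intros S sm)
    also have "\<dots> = 2 * divform \<xi> x l"
      by (simp add: lap_inner_mult[OF S sm x] harm divform_def sum_distrib_left)
    finally show ?thesis .
  qed
qed

text \<open>Cartan's formula \<open>L\<^sub>X = d \<iota>\<^sub>X + \<iota>\<^sub>X d\<close> for the radial field \<open>X\<close>.\<close>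

lemma dform_radial:
  fixes \<xi> :: "'a::euclidean_space form"
  assumes S: "open S" and \<xi>: "smooth_form_on k S \<xi>"
    and rad: "\<And>y l. y \<in> S \<Longrightarrow> \<xi> y (y # l) = 0" and x: "x \<in> S" and J: "length J = k"
  shows "dform \<xi> x (x # J) = eul (\<lambda>y. \<xi> y J) x + real k * \<xi> x J"
proof -
  note alt = smooth_form_onD(1)[OF \<xi>] and sm = smooth_form_onD(2)[OF \<xi>]
  \<comment> \<open>Differentiating \<open>rad\<close> accounts for the moving entry: with the entry
    frozen at \<open>x\<close>, only the negative of the form with \<open>w\<close> inserted
    remains.\<close>
  have "pd w (\<lambda>y. \<xi> y (x # l)) x = - \<xi> x (w # l)" for w l
  proof -
    have "pd w (\<lambda>y. \<xi> y (y # l)) x = pd w (\<lambda>y. 0) x"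
      by (rule pd_cong[OF S rad smooth_on_contraction[OF S sm alternating_form_head(1)[OF alt]] x])
    then show ?thesis
      using pd_contraction[OF S sm alternating_form_head(1)[OF alt] x, of w l] by (simp add: pd_const)
  qed
  then have "dform \<xi> x (x # J) = pd x (\<lambda>y. \<xi> y J) x - alt_sum (\<lambda>w l. - \<xi> x (w # l)) J"
    unfolding dform_def alt_sum_Cons by simp
  also have "alt_sum (\<lambda>w l. - \<xi> x (w # l)) J = - (real k * \<xi> x J)"
    using alt_sum_contract[OF alt[OF x] J] by (simp add: alt_sum_def sum_negf)
  finally show ?thesis by (simp add: eul_def)
qed

lemma lap_pd_zero:
  assumes "open S" "smooth_on S g" "\<And>y. y \<in> S \<Longrightarrow> lap g y = 0" "x \<in> S"
  shows "lap (pd v g) x = 0"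
  using pd_lap[OF assms(1,2,4), of v] pd_cong[OF assms(1,3) smooth_on_lap[OF assms(1,2)] assms(4), of v]
  by (simp add: pd_const)

lemma lap_dform_zero:
  assumes S: "open S" and sm: "\<And>vs. smooth_on S (\<lambda>x. \<beta> x vs)"
    and harm: "\<And>y vs. y \<in> S \<Longrightarrow> lap (\<lambda>y. \<beta> y vs) y = 0" and x: "x \<in> S"
  shows "lap (\<lambda>y. dform \<beta> y vs) x = 0" "lap (\<lambda>y. divform \<beta> y vs) x = 0"
proof -
  have z: "lap (pd v (\<lambda>y. \<beta> y l)) x = 0" for v l by (rule lap_pd_zero[OF S sm harm x])
  show "lap (\<lambda>y. dform \<beta> y vs) x = 0" unfolding dform_def alt_sum_def
    by (subst lap_sum[OF S], (intro smooth_intros S sm x)+, subst lap_cmult[OF S],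
        (intro smooth_intros S sm x)+) (simp add: z)
  show "lap (\<lambda>y. divform \<beta> y vs) x = 0" unfolding divform_def
    by (subst lap_sum[OF S], (intro smooth_intros S sm x)+) (simp add: z)
qed

lemma dform_cong:
  assumes "open S" "\<And>y vs. y \<in> S \<Longrightarrow> \<alpha> y vs = \<beta> y vs" "\<And>vs. smooth_on S (\<lambda>y. \<alpha> y vs)" "x \<in> S"
  shows "dform \<alpha> x vs = dform \<beta> x vs"
  unfolding dform_def alt_sum_def
  by (intro sum.cong refl arg_cong2[where f = "(*)"] pd_cong[OF assms(1,2,3,4)])

text \<open>Each derivative in the exterior derivative passes the Euler operator at the cost of one
  extra copy, which raises \<open>c\<close> by 2.\<close>

lemma dform_cmult_add_eul:
  fixes \<xi> :: "'a::euclidean_space form"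
  assumes S: "open S" and sm: "\<And>vs. smooth_on S (\<lambda>y. \<xi> y vs)" and x: "x \<in> S"
  shows "dform (\<lambda>y vs. c * \<xi> y vs + 2 * eul (\<lambda>y. \<xi> y vs) y) x vs
    = (c + 2) * dform \<xi> x vs + 2 * eul (\<lambda>y. dform \<xi> y vs) x"
proof -
  have e: "pd w (\<lambda>y. c * \<xi> y l + 2 * eul (\<lambda>y. \<xi> y l) y) x
      = (c + 2) * pd w (\<lambda>y. \<xi> y l) x + 2 * eul (pd w (\<lambda>y. \<xi> y l)) x" for w l
    by (subst pd_add[of S], (intro smooth_intros smooth_on_eul S sm x)+,
        subst pd_cmult[OF sm x], subst pd_cmult[OF smooth_on_eul[OF S sm] x])
       (simp add: pd_eul[OF S sm x] algebra_simps)
  have "eul (\<lambda>y. dform \<xi> y vs) x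
      = (\<Sum>i<length vs. (-1) ^ i * eul (pd (vs ! i) (\<lambda>y. \<xi> y (omit i vs))) x)"
    unfolding dform_def alt_sum_def eul_def
    by (subst pd_sum[of _ S], (intro smooth_intros S sm x)+, subst pd_cmult[of S],
        (intro smooth_intros S sm x)+) (rule refl)
  then show ?thesis
    unfolding dform_def alt_sum_def e by (simp add: algebra_simps sum.distrib sum_distrib_left)
qed

text \<open>Multiplied by \<open>m\<close>, the expression exceeds m^2 + 2m - 4p, which is at least
  (m - 1)^2 + 3 because p is at most m - 1. It is the damping coefficient of the differentiated
  radial equation.\<close>

lemma radial_eigen_coeff_pos:
  fixes m \<mu> p :: real
  assumes "0 < m" "p + 1 \<le> m" "\<mu> * m < p * (m + 2)"
  shows "m + 2 * p + 2 - 2 * \<mu> > 0"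
proof -
  have "0 \<le> (m - 1)\<^sup>2" by simp
  then have "m * (m + 2 * p + 2 - 2 * \<mu>) > 0"
    using assms(2,3) by (simp add: algebra_simps power2_eq_square)
  then show ?thesis using assms(1) by (simp add: zero_less_mult_iff)
qed

lemma eigenvalue_lower_bound:
  fixes \<beta> :: "'a::euclidean_space form"
  assumes U: "open U" "cball 0 1 \<subseteq> U" and \<beta>: "smooth_form_on p U \<beta>" and p: "1 \<le> p" "p < DIM('a)"
    and harm: "\<And>y vs. y \<in> ball 0 1 \<Longrightarrow> lap (\<lambda>y. \<beta> y vs) y = 0"
    and tang: "\<And>y vs. y \<in> sphere 0 1 \<Longrightarrow> \<beta> y (y # vs) = 0"
    and eig: "\<And>y vs. y \<in> sphere 0 1 \<Longrightarrow> set vs \<subseteq> tangent_space y \<Longrightarrow> dform \<beta> y (y # vs) = \<mu> * \<beta> y vs"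
    and low: "\<mu> * DIM('a) < real p * (real DIM('a) + 2)" "\<mu> < real p + 1"
    and x: "x \<in> cball 0 1"
  shows "\<beta> x vs = 0"
proof -
  let ?m = "real DIM('a)" and ?B = "ball 0 1 :: 'a set"
  obtain q where q: "p = Suc q" using p by (cases p) auto
  have sub: "?B \<subseteq> U" using U(2) by auto
  note alt = smooth_form_onD(1)[OF \<beta>] and sm = smooth_form_onD(2)[OF \<beta>]
  have altB: "alternating_form p (\<beta> y)" if "y \<in> ?B" for y using alt sub that by auto
  have smB: "smooth_on ?B (\<lambda>y. \<beta> y vs)" for vs by (rule smooth_on_subset[OF sm sub])
  note headU = alternating_form_head(1)[OF alt] and headB = alternating_form_head(1)[OF altB]
  have d\<beta>: "smooth_form_on (Suc p) U (dform \<beta>)" by (rule smooth_form_on_dform[OF U(1) \<beta>])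
  note dalt = smooth_form_onD(1)[OF d\<beta>] and dsm = smooth_form_onD(2)[OF d\<beta>]
  have dsmB: "smooth_on ?B (\<lambda>y. dform \<beta> y vs)" for vs by (rule smooth_on_subset[OF dsm sub])
  note dheadU = alternating_form_head(1)[OF dalt]
  have dheadB: "linear (\<lambda>v. dform \<beta> y (v # l))" if "y \<in> ?B" for y l using dheadU sub that by auto
  have sa: "smooth_on U (\<lambda>y. divform \<beta> y J)" for J by (rule smooth_on_divform[OF U(1) sm])
  have sb: "smooth_on U (\<lambda>y. divform (dform \<beta>) y J)" for J by (rule smooth_on_divform[OF U(1) dsm])
  have saB: "smooth_on ?B (\<lambda>y. divform \<beta> y J)" for J by (rule smooth_on_subset[OF sa sub])
  have dharm: "lap (\<lambda>y. dform \<beta> y vs) y = 0" if "y \<in> ?B" for y vs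
    by (rule lap_dform_zero(1)[where \<beta> = \<beta>, OF open_ball smB harm that])

  \<comment> \<open>Division of the two contractions by \<open>bdf\<close>\<close>
  have "\<exists>g. smooth_on U g \<and> (\<forall>y\<in>?B. \<beta> y (y # J) = bdf y * g y \<and> ?m * g y + 2 * eul g y = divform \<beta> y J)" for J
  proof (rule divide_by_bdf[OF U smooth_on_contraction[where \<xi> = \<beta>, OF U(1) sm headU] sa])
    show "lap (\<lambda>y. \<beta> y (y # J)) y = 2 * divform \<beta> y J" if "y \<in> ?B" for y
      by (rule lap_contraction[where \<xi> = \<beta>, OF open_ball smB headB that harm[OF that]])
    show "lap (\<lambda>y. divform \<beta> y J) y = 0" if "y \<in> ?B" for y
      by (rule lap_dform_zero(2)[where \<beta> = \<beta>, OF open_ball smB harm that])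
  qed (use tang in auto)
  then obtain \<psi> where \<psi>U: "\<And>J. smooth_on U (\<psi> J)"
    and \<psi>: "\<And>J y. y \<in> ?B \<Longrightarrow> \<beta> y (y # J) = bdf y * \<psi> J y"
    and \<psi>a: "\<And>J y. y \<in> ?B \<Longrightarrow> ?m * \<psi> J y + 2 * eul (\<psi> J) y = divform \<beta> y J"
    by metis
  have "\<exists>g. smooth_on U g \<and> (\<forall>y\<in>?B. dform \<beta> y (y # J) - \<mu> * \<beta> y J = bdf y * g y
      \<and> ?m * g y + 2 * eul g y = divform (dform \<beta>) y J)" for J
  proof (rule divide_by_bdf[OF U _ sb])
    have c: "smooth_on U (\<lambda>y. dform \<beta> y (y # J))" "smooth_on ?B (\<lambda>y. dform \<beta> y (y # J))"
      using smooth_on_contraction[where \<xi> = "dform \<beta>", OF U(1) dsm dheadU] smooth_on_subset[OF _ sub] by blast+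
    show "smooth_on U (\<lambda>y. dform \<beta> y (y # J) - \<mu> * \<beta> y J)" by (intro smooth_intros U c sm)
    show "lap (\<lambda>y. dform \<beta> y (y # J) - \<mu> * \<beta> y J) y = 2 * divform (dform \<beta>) y J" if y: "y \<in> ?B" for y
    proof -
      have "lap (\<lambda>y. dform \<beta> y (y # J)) y = 2 * divform (dform \<beta>) y J"
        by (rule lap_contraction[where \<xi> = "dform \<beta>", OF open_ball dsmB dheadB y dharm[OF y]])
      then show ?thesis
        by (subst lap_diff[of ?B], (intro smooth_intros smB c open_ball y)+)
           (simp add: lap_cmult[OF open_ball smB y] harm[OF y])
    qed
    show "lap (\<lambda>y. divform (dform \<beta>) y J) y = 0" if "y \<in> ?B" for y
      by (rule lap_dform_zero(2)[where \<beta> = "dform \<beta>", OF open_ball dsmB dharm that])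
    fix y :: 'a assume y: "y \<in> sphere 0 1"
    then have yU: "y \<in> U" using U(2) by auto
    show "dform \<beta> y (y # J) - \<mu> * \<beta> y J = 0"
    \<comment> \<open>\<open>eig\<close> concerns tangential lists only; with the normal in front
      both terms vanish separately, so the difference vanishes on all lists, as the division
      requires.\<close>
    proof (rule alternating_form_zero_if_tangential[where f = "\<lambda>J. dform \<beta> y (y # J) - \<mu> * \<beta> y J"])
      show "alternating_form p (\<lambda>J. dform \<beta> y (y # J) - \<mu> * \<beta> y J)"
        by (intro alternating_form_diff alternating_form_scale alternating_form_contract dalt alt yU)
      show "dform \<beta> y (y # y # vs) - \<mu> * \<beta> y (y # vs) = 0" for vs
        using alternating_form_head(2)[OF dalt[OF yU], of y "[]"] tang[OF y] by simp
    qed (use y eig in auto)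
  qed
  then obtain \<gamma> where \<gamma>U: "\<And>J. smooth_on U (\<gamma> J)"
    and \<gamma>: "\<And>J y. y \<in> ?B \<Longrightarrow> dform \<beta> y (y # J) - \<mu> * \<beta> y J = bdf y * \<gamma> J y"
    and \<gamma>b: "\<And>J y. y \<in> ?B \<Longrightarrow> ?m * \<gamma> J y + 2 * eul (\<gamma> J) y = divform (dform \<beta>) y J"
    by metis
  have \<psi>B: "smooth_on ?B (\<psi> J)" and \<gamma>B: "smooth_on ?B (\<gamma> J)" for J
    using smooth_on_subset[OF _ sub] \<psi>U \<gamma>U by blast+

  \<comment> \<open>The radial equation\<close>
  define \<xi> where "\<xi> = (\<lambda>y J. \<psi> J y)"
  define \<zeta> where "\<zeta> = (\<lambda>y J. \<gamma> J y)"
  \<comment> \<open>The quotients were chosen separately for each list. Dividing by the nonzero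
    \<open>bdf\<close> inside the ball shows that they still form an alternating form.\<close>
  have \<xi>_eq: "\<xi> y = (\<lambda>J. (1 / bdf y) * \<beta> y (y # J))" if "y \<in> ?B" for y
    using \<psi>[OF that] bdf_neg[OF that] by (auto simp: \<xi>_def)
  have \<zeta>_eq: "\<zeta> y = (\<lambda>J. (1 / bdf y) * (dform \<beta> y (y # J) - \<mu> * \<beta> y J))" if "y \<in> ?B" for y
    using \<gamma>[OF that] bdf_neg[OF that] by (auto simp: \<zeta>_def)
  have \<xi>alt: "alternating_form q (\<xi> y)" if "y \<in> ?B" for y
    unfolding \<xi>_eq[OF that]
    by (intro alternating_form_scale alternating_form_contract altB[OF that, unfolded q])
  have \<xi>form: "smooth_form_on q ?B \<xi>"
    using \<xi>alt \<psi>B by (simp add: smooth_form_on_def \<xi>_def)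
  have \<xi>rad: "\<xi> y (y # l) = 0" if "y \<in> ?B" for y l
    using alternating_form_head(2)[OF altB[OF that], of y "[]"] by (simp add: \<xi>_eq[OF that])
  have \<zeta>head: "linear (\<lambda>v. \<zeta> y (v # l))" if y: "y \<in> ?B" for y l
  proof -
    have "alternating_form p (\<zeta> y)" unfolding \<zeta>_eq[OF y]
      by (intro alternating_form_scale alternating_form_diff alternating_form_contract altB[OF y] dalt)
         (use sub y in auto)
    then show ?thesis by (rule alternating_form_head(1))
  qed
  have \<zeta>sm: "smooth_on ?B (\<lambda>y. \<zeta> y l)" for l by (simp add: \<zeta>_def \<gamma>B)
  have \<zeta>rad: "\<zeta> y (y # l) = - \<mu> * \<psi> l y" if y: "y \<in> ?B" for y l
    using alternating_form_head(2)[OF dalt, of y y "[]"] y sub \<psi>[OF y] bdf_neg[OF y]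
    by (auto simp: \<zeta>_eq[OF y])
  have d\<xi>form: "smooth_form_on (Suc q) ?B (dform \<xi>)" by (rule smooth_form_on_dform[OF open_ball \<xi>form])
  note d\<xi>sm = smooth_form_onD(2)[OF d\<xi>form] and d\<xi>head = alternating_form_head(1)[OF smooth_form_onD(1)[OF d\<xi>form]]

  have div_d: "divform (dform \<beta>) y J = - dform (divform \<beta>) y J" if y: "y \<in> ?B" for y J
    using divform_dform[OF open_ball smB y] harm[OF y] by simp
  have ode: "2 * eul (eul (\<psi> J)) y + (?m + 2 * q - 2 * \<mu>) * eul (\<psi> J) y + (?m * q - \<mu> * (?m - 2)) * \<psi> J y = 0"
    if y: "y \<in> ?B" and J: "length J = q" for J y
  proof -
    define \<kappa> where "\<kappa> = (\<lambda>z. eul (\<psi> J) z + real q * \<psi> J z)"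
    have \<kappa>: "dform \<xi> z (z # J) = \<kappa> z" if "z \<in> ?B" for z
      using dform_radial[where \<xi> = \<xi>, OF open_ball \<xi>form \<xi>rad that J] by (simp add: \<kappa>_def \<xi>_def)
    have e\<kappa>: "eul \<kappa> y = eul (eul (\<psi> J)) y + q * eul (\<psi> J) y"
      unfolding \<kappa>_def
      by (subst eul_add[of ?B], (intro smooth_intros smooth_on_eul \<psi>B open_ball y)+)
         (simp add: eul_cmult[OF \<psi>B y])
    have "eul (\<lambda>z. dform \<xi> z (z # J)) y = eul \<kappa> y"
      by (rule eul_cong[OF open_ball \<kappa> smooth_on_contraction[where \<xi> = "dform \<xi>", OF open_ball d\<xi>sm d\<xi>head] y])
    \<comment> \<open>In \<open>dform_cmult_add_eul\<close> the entry stays frozen at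
      \<open>y\<close> during differentiation, whereas \<open>\<kappa>\<close> moves it; the
      difference is one copy of \<open>\<kappa>\<close>.\<close>
    then have e1: "eul (\<lambda>z. dform \<xi> z (y # J)) y = eul \<kappa> y - \<kappa> y"
      using eul_contraction[where \<xi> = "dform \<xi>", OF open_ball d\<xi>sm d\<xi>head y, of J] \<kappa>[OF y] by simp
    have "dform (divform \<beta>) y (y # J) = dform (\<lambda>z vs. ?m * \<xi> z vs + 2 * eul (\<lambda>z. \<xi> z vs) z) y (y # J)"
      by (rule dform_cong[where \<alpha> = "divform \<beta>", OF open_ball _ saB y]) (simp add: \<xi>_def \<psi>a)
    also have "\<dots> = (?m + 2) * dform \<xi> y (y # J) + 2 * eul (\<lambda>z. dform \<xi> z (y # J)) y"
      by (rule dform_cmult_add_eul[where \<xi> = \<xi>, OF open_ball smooth_form_onD(2)[OF \<xi>form] y])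
    also have "\<dots> = (?m + 2) * \<kappa> y + 2 * (eul \<kappa> y - \<kappa> y)" by (simp only: e1 \<kappa>[OF y])
    finally have da: "dform (divform \<beta>) y (y # J) = ?m * \<kappa> y + 2 * eul \<kappa> y" by (simp add: algebra_simps)
    have "eul (\<lambda>z. \<zeta> z (z # J)) y = eul (\<lambda>z. - \<mu> * \<psi> J z) y"
      by (rule eul_cong[OF open_ball \<zeta>rad smooth_on_contraction[where \<xi> = \<zeta>, OF open_ball \<zeta>sm \<zeta>head] y])
    also have "\<dots> = - \<mu> * eul (\<psi> J) y" unfolding eul_def by (rule pd_cmult[OF \<psi>B y])
    finally have e2: "eul (\<gamma> (y # J)) y = - \<mu> * eul (\<psi> J) y + \<mu> * \<psi> J y"
      using eul_contraction[where \<xi> = \<zeta>, OF open_ball \<zeta>sm \<zeta>head y, of J] \<zeta>rad[OF y, of J] by (simp add: \<zeta>_def)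
    have g: "\<gamma> (y # J) y = - \<mu> * \<psi> J y" using \<zeta>rad[OF y, of J] by (simp add: \<zeta>_def)
    \<comment> \<open>The Euler equation of \<open>\<gamma>\<close> with the radial vector as first
      entry: the left side uses that the contraction of \<open>\<gamma>\<close> is
      \<open>-\<mu>\<close> times \<open>\<psi>\<close>, the right side comes from Cartan's formula
      for \<open>\<xi>\<close>.\<close>
    have "?m * (- \<mu> * \<psi> J y) + 2 * (- \<mu> * eul (\<psi> J) y + \<mu> * \<psi> J y) = - (?m * \<kappa> y + 2 * eul \<kappa> y)"
      using \<gamma>b[OF y, of "y # J"] unfolding e2 g div_d[OF y] da .
    then show ?thesis unfolding e\<kappa> by (simp add: \<kappa>_def algebra_simps)
  qed

  \<comment> \<open>Vanishing of the radial part\<close>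
  have \<psi>_zero: "\<psi> J y = 0" if y: "y \<in> ?B" for J y
  proof (cases "length J = q")
    case False
    then show ?thesis using alternating_formD(1)[OF \<xi>alt[OF y]] by (simp add: \<xi>_def)
  next
    case True
    let ?c = "?m + 2 * q - 2 * \<mu>" and ?d = "?m * q - \<mu> * (?m - 2)"
    have se: "smooth_on ?B (eul (\<psi> J))" "smooth_on ?B (eul (eul (\<psi> J)))"
      by (intro smooth_on_eul open_ball \<psi>B)+
    \<comment> \<open>The coefficient \<open>?d\<close> may be negative, so the energy argument
      fails for \<open>\<psi>\<close> itself. For a derivative of \<open>\<psi>\<close> the
      zeroth-order coefficient is \<open>2 + ?c + ?d\<close>, which equals
      \<open>p * (m + 2) - \<mu> * m\<close>, and the first-order one is
      \<open>?c + 4\<close>.\<close>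
    have "pd v (\<psi> J) z = 0" if z: "z \<in> ?B" for v z
    proof (rule euler_ode_second_order_zero[OF smooth_on_pd[OF \<psi>B] _ _ _ z])
      show "0 \<le> ?m + 2 * p + 2 - 2 * \<mu>"
        using radial_eigen_coeff_pos[of ?m p \<mu>] p low by simp
      show "0 < real p * (?m + 2) - \<mu> * ?m" using low by simp
      fix w assume w: "w \<in> ?B"
      let ?u = "pd v (\<psi> J)"
      have su: "smooth_on ?B ?u" by (rule smooth_on_pd[OF \<psi>B])
      have e1: "pd v (eul (\<psi> J)) w' = eul ?u w' + ?u w'" if "w' \<in> ?B" for w'
        by (rule pd_eul[OF open_ball \<psi>B that])
      have "pd v (eul (eul (\<psi> J))) w = eul (pd v (eul (\<psi> J))) w + pd v (eul (\<psi> J)) w"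
        by (rule pd_eul[OF open_ball se(1) w])
      also have "eul (pd v (eul (\<psi> J))) w = eul (\<lambda>w. eul ?u w + ?u w) w"
        by (rule eul_cong[OF open_ball e1 smooth_on_pd[OF se(1)] w])
      also have "\<dots> = eul (eul ?u) w + eul ?u w"
        by (rule eul_add[OF smooth_on_eul[OF open_ball su] su w])
      finally have e2: "pd v (eul (eul (\<psi> J))) w = eul (eul ?u) w + 2 * eul ?u w + ?u w"
        using e1[OF w] by simp
      have "pd v (\<lambda>y. 2 * eul (eul (\<psi> J)) y + ?c * eul (\<psi> J) y + ?d * \<psi> J y) w = pd v (\<lambda>y. 0) w"
        by (rule pd_cong[OF open_ball _ _ w]) (intro ode True smooth_intros se \<psi>B open_ball | assumption)+
      moreover have "pd v (\<lambda>y. 2 * eul (eul (\<psi> J)) y + ?c * eul (\<psi> J) y + ?d * \<psi> J y) w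
          = 2 * pd v (eul (eul (\<psi> J))) w + ?c * pd v (eul (\<psi> J)) w + ?d * ?u w"
        by (subst pd_add[of ?B], (intro smooth_intros se \<psi>B open_ball w)+,
            subst pd_add[of ?B], (intro smooth_intros se \<psi>B open_ball w)+)
           (simp add: pd_cmult[OF se(1) w] pd_cmult[OF se(2) w] pd_cmult[OF \<psi>B w])
      ultimately have "2 * (eul (eul ?u) w + 2 * eul ?u w + ?u w) + ?c * (eul ?u w + ?u w) + ?d * ?u w = 0"
        using e2 e1[OF w] by (simp add: pd_const)
      then show "2 * eul (eul ?u) w + (?m + 2 * p + 2 - 2 * \<mu>) * eul ?u w + (real p * (?m + 2) - \<mu> * ?m) * ?u w = 0"
        by (simp add: q algebra_simps)
    qed
    then have "\<psi> J y = \<psi> J 0" using pd_zero_imp_const[OF \<psi>B _ y] by blast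
    \<comment> \<open>At the centre the contracted vector is zero while \<open>bdf\<close> is
      -1.\<close>
    also have "\<psi> J 0 = 0"
      using \<psi>[of 0 J] linear_0[OF headB[of 0 J]] by (simp add: bdf_def)
    finally show ?thesis .
  qed

  \<comment> \<open>Vanishing of the whole form\<close>
  have rad: "\<beta> y (y # J) = 0" if "y \<in> ?B" for y J using \<psi>[OF that] \<psi>_zero[OF that] by simp
  have a0: "divform \<beta> y J = 0" if y: "y \<in> ?B" for y J
  proof -
    have "eul (\<psi> J) y = eul (\<lambda>y. 0) y" by (rule eul_cong[OF open_ball \<psi>_zero \<psi>B y])
    then show ?thesis using \<psi>a[OF y, of J] \<psi>_zero[OF y] by (simp add: eul_def pd_const)
  qed
  have b0: "divform (dform \<beta>) y J = 0" if y: "y \<in> ?B" for y J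
  proof -
    have "dform (divform \<beta>) y J = dform (\<lambda>y J. 0) y J" by (rule dform_cong[where \<alpha> = "divform \<beta>", OF open_ball a0 saB y])
    then show ?thesis using div_d[OF y] by (simp add: dform_def alt_sum_def pd_const)
  qed
  have \<gamma>0: "\<gamma> J y = 0" if "y \<in> ?B" for J y
    by (rule euler_ode_first_order_zero[OF \<gamma>B, of "?m / 2"]) (use \<gamma>b b0 that in \<open>auto simp: field_simps\<close>)
  \<comment> \<open>The form is now homogeneous of degree \<open>\<mu> - p\<close>, less than 1. Its
    first derivatives have negative degree and vanish by smoothness at the centre.\<close>
  have const: "\<beta> y J = \<beta> 0 J" if y: "y \<in> ?B" and J: "length J = p" for y J
  proof (rule pd_zero_imp_const[OF smB _ y])
    have eq: "eul (\<lambda>y. \<beta> y J) z = (\<mu> - real p) * \<beta> z J" if z: "z \<in> ?B" for z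
    proof -
      have "smooth_form_on p ?B \<beta>" using altB smB by (simp add: smooth_form_on_def)
      then show ?thesis
        using dform_radial[where \<xi> = \<beta>, OF open_ball _ rad z J] \<gamma>[OF z, of J] \<gamma>0[OF z, of J] by (simp add: algebra_simps)
    qed
    fix v z assume z: "z \<in> ?B"
    show "pd v (\<lambda>y. \<beta> y J) z = 0"
    proof (rule euler_ode_first_order_zero[OF smooth_on_pd[OF smB] _ _ z])
      show "0 < real p + 1 - \<mu>" using low by simp
      fix w assume w: "w \<in> ?B"
      have "pd v (eul (\<lambda>y. \<beta> y J)) w = pd v (\<lambda>z. (\<mu> - real p) * \<beta> z J) w"
        by (rule pd_cong[OF open_ball eq smooth_on_eul[OF open_ball smB] w])
      then show "eul (pd v (\<lambda>y. \<beta> y J)) w + (real p + 1 - \<mu>) * pd v (\<lambda>y. \<beta> y J) w = 0"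
        unfolding pd_eul[OF open_ball smB w] pd_cmult[OF smB w] by (simp add: algebra_simps)
    qed
  qed
  have zero: "\<beta> 0 J = 0" for J
  proof (cases "length J = p")
    case False
    then show ?thesis using alternating_formD(1)[OF altB[of 0]] by simp
  next
    case True
    then obtain v K where J: "J = v # K" "length K = q" using q by (cases J) auto
    \<comment> \<open>Rescaling puts any vector strictly inside the ball, where constancy and
      \<open>rad\<close> apply to it both as point and as entry.\<close>
    define y where "y = v /\<^sub>R (norm v + 1)"
    have n: "norm v + 1 > 0" by (smt (verit) norm_ge_zero)
    then have y: "y \<in> ?B" by (simp add: y_def field_simps)
    have "v = (norm v + 1) *\<^sub>R y" using n by (simp add: y_def)
    then have "\<beta> 0 (v # K) = (norm v + 1) * \<beta> 0 (y # K)"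
      using linear_cmul[OF headB[of 0 K]] by (metis centre_in_ball real_scaleR_def zero_less_one)
    also have "\<beta> 0 (y # K) = 0" using const[OF y, of "y # K"] rad[OF y] J q by simp
    finally show ?thesis using J by simp
  qed
  have ball: "\<beta> y vs = 0" if y: "y \<in> ?B" for y vs
  proof (cases "length vs = p")
    case True
    then show ?thesis using const[OF y] zero by simp
  next
    case False
    then show ?thesis using alternating_formD(1)[OF altB[OF y]] by simp
  qed
  have "continuous_on (closure ?B) (\<lambda>y. \<beta> y vs)"
    using continuous_on_subset[OF smooth_on_continuous[OF sm] U(2)] by simp
  then show ?thesis
    by (rule continuous_constant_on_closure[OF _ ball]) (use x in auto)
qed

section \<open>The Dirichlet-to-Neumann operator\<close>

lemma alt_sum_cong:
  "(\<And>i. i < length vs \<Longrightarrow> F (vs ! i) (omit i vs) = G (vs ! i) (omit i vs)) \<Longrightarrow> alt_sum F vs = alt_sum G vs"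
  by (simp add: alt_sum_def)

lemma alt_sum_zero: "(\<And>w l. w \<in> set vs \<Longrightarrow> F w l = 0) \<Longrightarrow> alt_sum F vs = 0"
  by (simp add: alt_sum_def)

lemma set_omit: "set (omit i vs) \<subseteq> set vs"
  using set_take_subset set_drop_subset by fastforce

lemma harmonic_tangential_extensionD:
  fixes \<omega> :: "'a::euclidean_space form"
  assumes "harmonic_tangential_extension p \<omega> \<eta>"
  obtains U \<beta> where "open U" "cball 0 1 \<subseteq> U" "smooth_form_on p U \<beta>"
    "\<And>x. x \<in> cball 0 1 \<Longrightarrow> \<eta> x = \<beta> x" "\<And>x vs. x \<notin> cball 0 1 \<Longrightarrow> \<eta> x vs = 0"
    "\<And>x vs. x \<in> cball 0 1 \<Longrightarrow> lap (\<lambda>y. \<beta> y vs) x = 0"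
    "\<And>x vs. x \<in> sphere 0 1 \<Longrightarrow> \<beta> x (x # vs) = 0"
    "\<And>x vs. x \<in> sphere 0 1 \<Longrightarrow> set vs \<subseteq> tangent_space x \<Longrightarrow> \<beta> x vs = \<omega> x vs"
proof -
  note h = assms[unfolded harmonic_tangential_extension_def]
  obtain U \<beta> where U: "open U" "cball 0 1 \<subseteq> U" and \<beta>: "smooth_form_on p U \<beta>"
    and eq: "\<And>x. x \<in> cball 0 1 \<Longrightarrow> \<eta> x = \<beta> x" and out: "\<And>x vs. x \<notin> cball 0 1 \<Longrightarrow> \<eta> x vs = 0"
    using h unfolding forms_def by blast
  show thesis
  proof (rule that[OF U \<beta> eq out])
    fix x :: 'a and vs assume x: "x \<in> cball 0 1"
    have "hodge_laplacian (cball 0 1) \<eta> x vs = - lap (\<lambda>y. \<beta> y vs) x"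
      by (rule hodge_laplacian_eq_lap[OF U smooth_form_onD(2)[OF \<beta>] _ x]) (simp add: eq)
    then show "lap (\<lambda>y. \<beta> y vs) x = 0" using h by (simp add: zero_form_def)
  next
    fix x :: 'a and vs assume x: "x \<in> sphere 0 1"
    then have xc: "x \<in> cball 0 1" "x \<in> U" using U by auto
    have "normal_contraction \<eta> x vs = 0" using h by (simp add: zero_form_def)
    then have "\<beta> x ((- x) # vs) = 0"
      using x by (simp add: normal_contraction_def inner_normal_def eq[OF xc(1)])
    then show "\<beta> x (x # vs) = 0"
      using linear_neg[OF alternating_form_head(1)[OF smooth_form_onD(1)[OF \<beta> xc(2)]], of x vs] by simp
  next
    fix x :: 'a and vs assume "x \<in> sphere 0 1" "set vs \<subseteq> tangent_space x"
    then have "pullback_sphere \<eta> x vs = \<beta> x vs" using eq[of x] by (simp add: pullback_sphere_def)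
    then show "\<beta> x vs = \<omega> x vs" using h by simp
  qed auto
qed

text \<open>On the sphere the pullback controls tangential lists and the contraction controls the
  normal entry, so the difference has boundary value zero in every component and the maximum
  principle applies. The two smooth extensions are compared on the intersection of their
  neighbourhoods.\<close>

lemma harmonic_tangential_extension_unique:
  assumes "harmonic_tangential_extension p \<omega> \<eta>" "harmonic_tangential_extension p \<omega> \<eta>'"
  shows "\<eta> = \<eta>'"
proof -
  obtain U \<beta> where U: "open U" "cball 0 1 \<subseteq> U" and \<beta>: "smooth_form_on p U \<beta>"
    and eq: "\<And>x. x \<in> cball 0 1 \<Longrightarrow> \<eta> x = \<beta> x" "\<And>x vs. x \<notin> cball 0 1 \<Longrightarrow> \<eta> x vs = 0"
    and harm: "\<And>x vs. x \<in> cball 0 1 \<Longrightarrow> lap (\<lambda>y. \<beta> y vs) x = 0"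
    and bd: "\<And>x vs. x \<in> sphere 0 1 \<Longrightarrow> \<beta> x (x # vs) = 0"
      "\<And>x vs. x \<in> sphere 0 1 \<Longrightarrow> set vs \<subseteq> tangent_space x \<Longrightarrow> \<beta> x vs = \<omega> x vs"
    by (rule harmonic_tangential_extensionD[OF assms(1)]) blast
  obtain U' \<beta>' where U': "open U'" "cball 0 1 \<subseteq> U'" and \<beta>': "smooth_form_on p U' \<beta>'"
    and eq': "\<And>x. x \<in> cball 0 1 \<Longrightarrow> \<eta>' x = \<beta>' x" "\<And>x vs. x \<notin> cball 0 1 \<Longrightarrow> \<eta>' x vs = 0"
    and harm': "\<And>x vs. x \<in> cball 0 1 \<Longrightarrow> lap (\<lambda>y. \<beta>' y vs) x = 0"
    and bd': "\<And>x vs. x \<in> sphere 0 1 \<Longrightarrow> \<beta>' x (x # vs) = 0"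
      "\<And>x vs. x \<in> sphere 0 1 \<Longrightarrow> set vs \<subseteq> tangent_space x \<Longrightarrow> \<beta>' x vs = \<omega> x vs"
    by (rule harmonic_tangential_extensionD[OF assms(2)]) blast
  let ?V = "U \<inter> U'"
  have V: "open ?V" "cball 0 1 \<subseteq> ?V" using U U' by auto
  have sm: "smooth_on ?V (\<lambda>y. \<beta> y vs)" "smooth_on ?V (\<lambda>y. \<beta>' y vs)" for vs
    using smooth_on_subset[OF smooth_form_onD(2)[OF \<beta>]] smooth_on_subset[OF smooth_form_onD(2)[OF \<beta>']] by auto
  have "\<beta> x vs - \<beta>' x vs = 0" if x: "x \<in> cball 0 1" for x vs
  proof (rule harmonic_zero_boundary[OF V _ _ _ x])
    show "smooth_on ?V (\<lambda>y. \<beta> y vs - \<beta>' y vs)" by (intro smooth_intros V sm)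
    show "lap (\<lambda>y. \<beta> y vs - \<beta>' y vs) y = 0" if "y \<in> ball 0 1" for y
    proof -
      have "y \<in> ?V" "y \<in> cball 0 1" using V(2) that by auto
      then show ?thesis using lap_diff[OF V(1) sm, of y vs vs] harm[of y] harm'[of y] by simp
    qed
    fix y :: 'a assume y: "y \<in> sphere 0 1"
    show "\<beta> y vs - \<beta>' y vs = 0"
    proof (rule alternating_form_zero_if_tangential[where f = "\<lambda>vs. \<beta> y vs - \<beta>' y vs"])
      show "alternating_form p (\<lambda>vs. \<beta> y vs - \<beta>' y vs)"
        by (intro alternating_form_diff smooth_form_onD(1)[OF \<beta>] smooth_form_onD(1)[OF \<beta>'])
           (use y V in auto)
    qed (use y bd bd' in auto)
  qed
  then have "\<eta> x vs = \<eta>' x vs" for x vs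
    using eq eq' by (cases "x \<in> cball 0 1") auto
  then show ?thesis by blast
qed

text \<open>The sign in the definition of the operator and the sign of the inner normal
  \<open>-x\<close> cancel.\<close>

lemma dn_operator_eq:
  fixes \<beta> :: "'a::euclidean_space form"
  assumes hte: "harmonic_tangential_extension p \<omega> \<eta>"
    and U: "cball 0 1 \<subseteq> U" "open U" "smooth_form_on p U \<beta>"
    and eq: "\<And>x. x \<in> cball 0 1 \<Longrightarrow> \<eta> x = \<beta> x"
  shows "dn_operator p \<omega> x vs
    = (if x \<in> sphere 0 1 \<and> set vs \<subseteq> tangent_space x then dform \<beta> x (x # vs) else 0)"
proof -
  have "(THE \<eta>. harmonic_tangential_extension p \<omega> \<eta>) = \<eta>"
    using hte harmonic_tangential_extension_unique by blast
  moreover have "exterior_derivative (cball 0 1) \<eta> x (- x # vs) = - dform \<beta> x (x # vs)"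
    if "x \<in> sphere 0 1"
  proof -
    have x: "x \<in> cball 0 1" using that by auto
    have "exterior_derivative (cball 0 1) \<eta> x (- x # vs) = dform \<beta> x (- x # vs)"
      by (rule exterior_derivative_eq_dform[OF U(1) smooth_form_onD(2)[OF U(3)] _ x]) (simp add: eq)
    also have "\<dots> = - dform \<beta> x (x # vs)"
      using smooth_form_onD(1)[OF smooth_form_on_dform[OF U(2,3)], of x] x U(1)
      by (intro linear_neg[OF alternating_form_head(1)]) auto
    finally show ?thesis .
  qed
  ultimately show ?thesis
    by (auto simp: dn_operator_def scale_form_def pullback_sphere_def normal_contraction_def inner_normal_def)
qed

text \<open>Only values below both bounds are excluded, hence the disjunction; which bound is the
  smaller depends on \<open>p\<close> and is settled in the theorem.\<close>

lemma eigenvalue_ge: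
  fixes p :: nat
  assumes p: "1 \<le> p" "p < DIM('a::euclidean_space)"
    and ev: "eigenvalue_on (dn_domain p) (dn_operator p :: 'a form \<Rightarrow> 'a form) \<mu>"
  shows "real p * (real DIM('a) + 2) / real DIM('a) \<le> \<mu> \<or> real p + 1 \<le> \<mu>"
proof (rule ccontr)
  assume neg: "\<not> ?thesis"
  obtain \<omega> :: "'a form" and \<eta> where \<omega>: "\<omega> \<noteq> zero_form" "dn_operator p \<omega> = scale_form \<mu> \<omega>"
    and hte: "harmonic_tangential_extension p \<omega> \<eta>"
    using ev by (auto simp: eigenvalue_on_def dn_domain_def)
  obtain U \<beta> where U: "open U" "cball 0 1 \<subseteq> U" and \<beta>: "smooth_form_on p U \<beta>"
    and eq: "\<And>x. x \<in> cball 0 1 \<Longrightarrow> \<eta> x = \<beta> x"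
    and harm: "\<And>x vs. x \<in> cball 0 1 \<Longrightarrow> lap (\<lambda>y. \<beta> y vs) x = 0"
    and tang: "\<And>x vs. x \<in> sphere 0 1 \<Longrightarrow> \<beta> x (x # vs) = 0"
    and \<omega>\<beta>: "\<And>x vs. x \<in> sphere 0 1 \<Longrightarrow> set vs \<subseteq> tangent_space x \<Longrightarrow> \<beta> x vs = \<omega> x vs"
    by (rule harmonic_tangential_extensionD[OF hte]) blast
  have zero: "\<beta> x vs = 0" if "x \<in> cball 0 1" for x vs
  proof (rule eigenvalue_lower_bound[OF U \<beta> p _ tang _ _ _ that])
    show "dform \<beta> y (y # vs) = \<mu> * \<beta> y vs" if "y \<in> sphere 0 1" "set vs \<subseteq> tangent_space y" for y vs
      using fun_cong[OF fun_cong[OF \<omega>(2)], of y vs] \<omega>\<beta>[OF that] that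
        dn_operator_eq[OF hte U(2,1) \<beta> eq, of y vs] by (simp add: scale_form_def)
    show "\<mu> * DIM('a) < real p * (real DIM('a) + 2)" using neg by (simp add: field_simps)
  qed (use harm neg in auto)
  have "\<omega> = pullback_sphere \<eta>" using hte by (simp add: harmonic_tangential_extension_def)
  also have "\<dots> = zero_form" by (intro ext) (auto simp: pullback_sphere_def zero_form_def eq zero)
  finally show False using \<omega>(1) by simp
qed

text \<open>The form itself supplies the extension demanded by \<open>dn_domain\<close>; the point
  \<open>x0\<close> with the tangential list \<open>vs0\<close> certifies that its restriction to
  the sphere is not zero.\<close>

lemma eigenvalue_from_harmonic_form:
  fixes \<beta> :: "'a::euclidean_space form"
  assumes \<beta>: "smooth_form_on p UNIV \<beta>"
    and harm: "\<And>x vs. length vs = p \<Longrightarrow> lap (\<lambda>y. \<beta> y vs) x = 0"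
    and tang: "\<And>x vs. x \<in> sphere 0 1 \<Longrightarrow> \<beta> x (x # vs) = 0"
    and eig: "\<And>x vs. x \<in> sphere 0 1 \<Longrightarrow> set vs \<subseteq> tangent_space x \<Longrightarrow> length vs = p \<Longrightarrow>
      dform \<beta> x (x # vs) = \<nu> * \<beta> x vs"
    and x0: "x0 \<in> sphere 0 1" "set vs0 \<subseteq> tangent_space x0" "\<beta> x0 vs0 \<noteq> 0"
  shows "eigenvalue_on (dn_domain p) (dn_operator p :: 'a form \<Rightarrow> 'a form) \<nu>"
proof -
  \<comment> \<open>Cut off outside the ball, to meet the normalisation in
    \<open>forms\<close>.\<close>
  define \<eta> where "\<eta> = (\<lambda>x vs. if x \<in> cball 0 1 then \<beta> x vs else 0)"
  have eq: "\<eta> x = \<beta> x" if "x \<in> cball 0 1" for x using that by (auto simp: \<eta>_def)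
  note alt = smooth_form_onD(1)[OF \<beta> UNIV_I]
  have len: "\<beta> y vs = 0" if "length vs \<noteq> p" for y vs by (rule alternating_formD(1)[OF alt that])
  have harm: "lap (\<lambda>y. \<beta> y vs) x = 0" for x vs
    using harm len by (cases "length vs = p") (auto simp: lap_const)
  have "hodge_laplacian (cball 0 1) \<eta> x vs = 0" for x vs
  proof (cases "x \<in> cball 0 1")
    case True
    then show ?thesis
      using hodge_laplacian_eq_lap[where \<eta> = \<eta> and vs = vs, OF open_UNIV _ smooth_form_onD(2)[OF \<beta>] _ True]
        eq harm by simp
  next
    case False
    then show ?thesis
      by (simp add: hodge_laplacian_def add_form_def exterior_derivative_def codifferential_def)
  qed
  moreover have "normal_contraction \<eta> x vs = 0" for x vs
    using linear_neg[OF alternating_form_head(1)[OF alt], of x x vs] tang[of x vs] eq[of x]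
    by (auto simp: normal_contraction_def inner_normal_def)
  moreover have "\<eta> \<in> forms p (cball 0 1)"
    unfolding forms_def using \<beta> eq by (auto simp: \<eta>_def intro!: exI[of _ UNIV] exI[of _ \<beta>])
  moreover have "pullback_sphere \<eta> = pullback_sphere \<beta>"
    using eq by (intro ext) (auto simp: pullback_sphere_def)
  ultimately have hte: "harmonic_tangential_extension p (pullback_sphere \<beta>) \<eta>"
    by (simp add: harmonic_tangential_extension_def zero_form_def fun_eq_iff)
  have "pullback_sphere \<beta> \<in> dn_domain p"
    unfolding dn_domain_def sphere_forms_def
    using \<beta> hte harmonic_tangential_extension_unique by blast
  moreover have "pullback_sphere \<beta> x0 vs0 \<noteq> 0" using x0 by (simp add: pullback_sphere_def)
  then have "pullback_sphere \<beta> \<noteq> zero_form" by (auto simp: zero_form_def)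
  moreover have pb: "pullback_sphere \<beta> x vs = (if x \<in> sphere 0 1 \<and> set vs \<subseteq> tangent_space x then \<beta> x vs else 0)" for x vs
    by (simp add: pullback_sphere_def)
  have "dn_operator p (pullback_sphere \<beta>) x vs = scale_form \<nu> (pullback_sphere \<beta>) x vs" for x vs
  proof -
    have "dform \<beta> x (x # vs) = \<nu> * \<beta> x vs" if "x \<in> sphere 0 1" "set vs \<subseteq> tangent_space x"
    proof (cases "length vs = p")
      case False
      then show ?thesis
        using alternating_formD(1)[OF smooth_form_onD(1)[OF smooth_form_on_dform[OF open_UNIV \<beta>] UNIV_I]] len
        by simp
    qed (use eig that in simp)
    then show ?thesis
      using dn_operator_eq[OF hte subset_UNIV open_UNIV \<beta> eq, of x vs]
      by (auto simp: scale_form_def pb)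
  qed
  then have "dn_operator p (pullback_sphere \<beta>) = scale_form \<nu> (pullback_sphere \<beta>)" by (intro ext)
  ultimately show ?thesis unfolding eigenvalue_on_def by blast
qed

text \<open>A boundary point \<open>b\<close> and an orthonormal tangential frame at it, on which
  the test forms are evaluated.\<close>

lemma basis_list:
  assumes "k < DIM('a::euclidean_space)"
  obtains b :: "'a::euclidean_space" and bs where "distinct (b # bs)" "set (b # bs) \<subseteq> Basis" "length bs = k"
    "norm b = 1" "set bs \<subseteq> tangent_space b"
proof -
  obtain S where S: "S \<subseteq> (Basis :: 'a set)" "card S = Suc k" "finite S"
    using obtain_subset_with_card_n[of "Suc k" "Basis :: 'a set"] assms by auto
  obtain cs where cs: "set cs = S" "distinct cs" using finite_distinct_list[OF S(3)] by blast
  then have "length cs = Suc k" using S distinct_card by fastforce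
  then obtain b bs where b: "cs = b # bs" "length bs = k" by (cases cs) auto
  then have "set bs \<subseteq> tangent_space b"
    using S cs by (force simp: tangent_space_def inner_normal_def intro: inner_not_same_Basis)
  with b S cs that[of b bs] show thesis by auto
qed

lemma eigenvalue_closed_mode:
  assumes "p < DIM('a::euclidean_space)"
  shows "eigenvalue_on (dn_domain p) (dn_operator p :: 'a form \<Rightarrow> 'a form) (real p + 1)"
proof -
  obtain b :: 'a and bs where b: "distinct (b # bs)" "set (b # bs) \<subseteq> Basis" "length bs = p"
    "norm b = 1" "set bs \<subseteq> tangent_space b"
    by (rule basis_list[OF assms])
  obtain c where c: "alternating_form (Suc p) c" "c (b # bs) = 1"
    using exists_alternating_form[OF b(1,2)] b(3) by auto
  note lin = alternating_form_head(1)[OF c(1)]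
  let ?\<beta> = "\<lambda>x vs. c (x # vs)"
  show ?thesis
  proof (rule eigenvalue_from_harmonic_form[of p ?\<beta> _ b bs])
    show "smooth_form_on p UNIV ?\<beta>"
      by (auto simp: smooth_form_on_def alternating_form_contract[OF c(1)] intro: smooth_on_linear[OF lin])
    show "lap (\<lambda>y. c (y # vs)) x = 0" for x vs by (rule lap_linear[OF lin])
    show "c (x # x # vs) = 0" for x vs using alternating_form_head(2)[OF c(1), of x "[]"] by simp
    \<comment> \<open>The coefficients are linear in the point, so the derivative only inserts the
      direction and \<open>alt_sum_contract\<close> in degree \<open>p + 1\<close> gives the
      factor.\<close>
    show "dform ?\<beta> x (x # vs) = (real p + 1) * c (x # vs)" if "length vs = p" for x vs
      unfolding dform_def pd_linear[OF lin] using alt_sum_contract[OF c(1), of "x # vs"] that by simp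
  qed (use b c in auto)
qed

text \<open>For a constant \<open>p\<close>-form \<open>c\<close>, the form
  \<open>x\<^sup>\<flat> \<and> \<iota>\<^sub>x c - (p / m) * \<bar>x\<bar>\<^sup>2 * c - (1 - p / m) * c\<close> is harmonic, is tangential on the sphere, and
  restricts to \<open>-c\<close> there.\<close>

lemma eigenvalue_degree_two_mode:
  assumes "1 \<le> p" "p < DIM('a::euclidean_space)"
  shows "eigenvalue_on (dn_domain p) (dn_operator p :: 'a form \<Rightarrow> 'a form)
    (real p * (real DIM('a) + 2) / real DIM('a))"
proof -
  let ?m = "real DIM('a)"
  obtain q where q: "p = Suc q" using assms(1) by (cases p) auto
  obtain b :: 'a and bs where b: "distinct (b # bs)" "set (b # bs) \<subseteq> Basis" "length bs = p"
    "norm b = 1" "set bs \<subseteq> tangent_space b"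
    by (rule basis_list[OF assms(2)])
  obtain c where c: "alternating_form p c" "c bs = 1"
    using exists_alternating_form[of bs] b by auto
  note lin = alternating_form_head(1)[OF c(1)]
  have cxx: "c (x # x # vs) = 0" for x vs using alternating_form_head(2)[OF c(1), of x "[]"] by simp
  \<comment> \<open>The Laplacian of \<open>W\<close> is \<open>2 * p * c\<close> and that of
    \<open>bdf\<close> is \<open>2 * m\<close>, so this ratio makes the difference harmonic.\<close>
  define t where "t = real p / ?m"
  have tm: "t * ?m = p" by (simp add: t_def)
  define W where "W = (\<lambda>x. alt_sum (\<lambda>w l. (x \<bullet> w) * c (x # l)))"
  \<comment> \<open>The summand 1 does not affect harmonicity. It is fixed by tangentiality: on the
    sphere contracting \<open>W\<close> with the normal gives the contraction of \<open>c\<close>,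
    which must cancel.\<close>
  define \<beta> where "\<beta> = (\<lambda>x vs. W x vs - c vs * (t * bdf x + 1))"
  have Wsm: "smooth_on UNIV (\<lambda>x. W x vs)" for vs
    unfolding W_def alt_sum_def by (intro smooth_intros open_UNIV smooth_on_linear[OF lin])
  have Walt: "alternating_form p (W x)" for x
    unfolding W_def q
  proof (rule alternating_form_alt_sum)
    show "alternating_form q (\<lambda>l. (x \<bullet> w) * c (x # l))" for w
      by (intro alternating_form_scale alternating_form_contract c(1)[unfolded q])
    show "linear (\<lambda>w. (x \<bullet> w) * c (x # l))" for l
      using linear_cmult[OF linear_inner_left[of x], of "c (x # l)"] by (simp add: inner_commute mult.commute)
  qed
  have bsm: "smooth_on UNIV (\<lambda>x::'a. t * bdf x + 1)"
    by (intro smooth_intros open_UNIV smooth_on_bdf)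
  have pdW: "pd w (\<lambda>x. W x vs) x = alt_sum (\<lambda>u l. (x \<bullet> u) * c (w # l) + (w \<bullet> u) * c (x # l)) vs" for w x vs
    unfolding W_def alt_sum_def
    by (subst pd_sum[of _ UNIV], (intro smooth_intros smooth_on_linear[OF lin] open_UNIV UNIV_I)+,
        subst pd_cmult[of UNIV], (intro smooth_intros smooth_on_linear[OF lin] open_UNIV UNIV_I)+,
        subst pd_mult[OF smooth_on_inner smooth_on_linear[OF lin] UNIV_I])
       (simp add: pd_inner pd_linear[OF lin])
  have pdb: "pd w (\<lambda>x. t * bdf x + 1) x = t * (2 * (w \<bullet> x))" for w x :: 'a
    by (subst pd_add[of UNIV], (intro smooth_intros open_UNIV smooth_on_bdf UNIV_I)+)
       (simp only: pd_const pd_cmult[OF smooth_on_bdf UNIV_I] pd_bdf add_0_right)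
  have pd\<beta>: "pd w (\<lambda>x. \<beta> x vs) x = alt_sum (\<lambda>u l. (x \<bullet> u) * c (w # l) + (w \<bullet> u) * c (x # l)) vs
      - c vs * (t * (2 * (w \<bullet> x)))" for w x vs
    unfolding \<beta>_def
    by (subst pd_diff[of UNIV], (intro smooth_intros open_UNIV smooth_on_bdf Wsm UNIV_I)+)
       (simp add: pdW pd_cmult[OF bsm UNIV_I] pdb)
  have perp: "x \<bullet> w = 0" "w \<bullet> x = 0" if "w \<in> tangent_space x" for x w :: 'a
    using that by (auto simp: tangent_space_def inner_normal_def inner_commute)
  have \<beta>_tang: "\<beta> x vs = - c vs" if "x \<in> sphere 0 1" "set vs \<subseteq> tangent_space x" for x vs
  proof -
    have "W x vs = 0" unfolding W_def by (rule alt_sum_zero) (use that perp in auto)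
    then show ?thesis using bdf_sphere[OF that(1)] by (simp add: \<beta>_def)
  qed
  show ?thesis
  proof (rule eigenvalue_from_harmonic_form[of p \<beta> _ b bs])
    show "smooth_form_on p UNIV \<beta>"
      unfolding smooth_form_on_def
    proof (intro conjI ballI allI)
      show "smooth_on UNIV (\<lambda>x. \<beta> x vs)" for vs
        unfolding \<beta>_def by (intro smooth_intros open_UNIV smooth_on_bdf Wsm)
      show "alternating_form p (\<beta> x)" for x
        unfolding \<beta>_def using alternating_form_scale[OF c(1), of "t * bdf x + 1"]
        by (intro alternating_form_diff Walt) (simp add: mult.commute)
    qed
    show "lap (\<lambda>y. \<beta> y vs) x = 0" if len: "length vs = p" for x vs
    proof -
      have "lap (\<lambda>y. W y vs) x = alt_sum (\<lambda>w l. 2 * c (w # l)) vs"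
        unfolding W_def alt_sum_def
        by (subst lap_sum[OF open_UNIV], (intro smooth_intros smooth_on_linear[OF lin] open_UNIV UNIV_I)+,
            subst lap_cmult[OF open_UNIV], (intro smooth_intros smooth_on_linear[OF lin] open_UNIV UNIV_I)+)
           (simp add: lap_inner_mult[OF open_UNIV smooth_on_linear[OF lin] UNIV_I] lap_linear[OF lin] pd_linear[OF lin])
      also have "\<dots> = 2 * alt_sum (\<lambda>w l. c (w # l)) vs"
        by (simp add: alt_sum_def sum_distrib_left mult.left_commute)
      also have "\<dots> = 2 * (p * c vs)" using alt_sum_contract[OF c(1) len] by simp
      finally have LW: "lap (\<lambda>y. W y vs) x = 2 * (p * c vs)" .
      have Lb: "lap (\<lambda>y::'a. t * bdf y + 1) x = 2 * p"
        by (subst lap_add[of UNIV], (intro smooth_intros open_UNIV smooth_on_bdf UNIV_I)+)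
           (simp add: lap_const lap_cmult[OF open_UNIV smooth_on_bdf UNIV_I] lap_bdf mult.left_commute[of t] tm)
      show ?thesis unfolding \<beta>_def
        by (subst lap_diff[of UNIV], (intro smooth_intros open_UNIV smooth_on_bdf Wsm UNIV_I)+)
           (simp add: LW lap_cmult[OF open_UNIV bsm UNIV_I] Lb)
    qed
    show "\<beta> x (x # vs) = 0" if x: "x \<in> sphere 0 1" for x vs
    proof -
      have "alt_sum (\<lambda>w l. (x \<bullet> w) * c (x # x # l)) vs = 0" by (rule alt_sum_zero) (simp add: cxx)
      then show ?thesis using x bdf_sphere[OF x] by (simp add: \<beta>_def W_def alt_sum_Cons dot_square_norm)
    qed
    show "dform \<beta> x (x # vs) = (real p * (?m + 2) / ?m) * \<beta> x vs"
      if x: "x \<in> sphere 0 1" and vs: "set vs \<subseteq> tangent_space x" and len: "length vs = p" for x vs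
    proof -
      have "pd x (\<lambda>y. \<beta> y vs) x = - c vs * (t * 2)"
      proof -
        have "alt_sum (\<lambda>u l. (x \<bullet> u) * c (x # l) + (x \<bullet> u) * c (x # l)) vs = 0"
          by (rule alt_sum_zero) (use vs perp in auto)
        then show ?thesis using x by (simp add: pd\<beta> dot_square_norm)
      qed
      moreover have "alt_sum (\<lambda>w l. pd w (\<lambda>y. \<beta> y (x # l)) x) vs = alt_sum (\<lambda>w l. c (w # l)) vs"
      proof (rule alt_sum_cong)
        fix i assume i: "i < length vs"
        have w: "x \<bullet> (vs ! i) = 0" "(vs ! i) \<bullet> x = 0" using vs perp nth_mem[OF i] by blast+
        have "alt_sum (\<lambda>u l. (x \<bullet> u) * c (vs ! i # x # l) + (vs ! i \<bullet> u) * c (x # x # l)) (omit i vs) = 0"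
          by (rule alt_sum_zero) (use vs perp(1) set_omit[of i vs] in \<open>auto simp: cxx subset_iff\<close>)
        then show "pd (vs ! i) (\<lambda>y. \<beta> y (x # omit i vs)) x = c (vs ! i # omit i vs)"
          using x w by (simp add: pd\<beta> alt_sum_Cons dot_square_norm)
      qed
      \<comment> \<open>The radial derivative contributes \<open>2 * t\<close> and the tangential
        ones \<open>p\<close>, in total \<open>p * (m + 2) / m\<close>; the minus signs match
        because the restriction of \<open>\<beta>\<close> is \<open>-c\<close>.\<close>
      ultimately have "dform \<beta> x (x # vs) = - c vs * (t * 2) - p * c vs"
        unfolding dform_def alt_sum_Cons using alt_sum_contract[OF c(1) len] by simp
      then show ?thesis using \<beta>_tang[OF x vs] by (simp add: t_def field_simps)
    qed
    show "\<beta> b bs \<noteq> 0" using \<beta>_tang[of b bs] b c by simp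
  qed (use b in auto)
qed

theorem corollary4:
  fixes n p :: nat
  assumes "DIM('a::euclidean_space) = n + 1"
    and "1 \<le> n" and "1 \<le> p" and "p \<le> n"
  shows "(real p \<le> (real n + 1) / 2 \<longrightarrow>
            first_eigenvalue_on (dn_domain p) (dn_operator p :: 'a form \<Rightarrow> 'a form)
              ((real n + 3) / (real n + 1) * real p)) \<and>
         ((real n + 1) / 2 \<le> real p \<longrightarrow>
            first_eigenvalue_on (dn_domain p) (dn_operator p :: 'a form \<Rightarrow> 'a form)
              (real p + 1))"
proof -
  let ?T = "dn_operator p :: 'a form \<Rightarrow> 'a form" and ?\<nu> = "(real n + 3) / (real n + 1) * real p"
  have p: "1 \<le> p" "p < DIM('a)" using assms by auto
  have \<nu>: "?\<nu> = real p * (real DIM('a) + 2) / real DIM('a)" using assms(1) by (simp add: field_simps)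
  have ge: "?\<nu> \<le> \<mu> \<or> real p + 1 \<le> \<mu>" if "eigenvalue_on (dn_domain p) ?T \<mu>" for \<mu>
    unfolding \<nu> by (rule eigenvalue_ge[OF p that])
  have ev: "eigenvalue_on (dn_domain p) ?T ?\<nu>" "eigenvalue_on (dn_domain p) ?T (real p + 1)"
    unfolding \<nu> using eigenvalue_degree_two_mode[OF p] eigenvalue_closed_mode[OF p(2)] by auto
  \<comment> \<open>In this form the comparison with \<open>p + 1\<close> is that of
    \<open>2 * p / (n + 1)\<close> with 1; the two values agree at \<open>p = (n + 1) / 2\<close>,
    where both cases of the theorem apply.\<close>
  have "?\<nu> = real p + 2 * real p / (real n + 1)" by (simp add: field_simps)
  then have "?\<nu> \<le> real p + 1" if "real p \<le> (real n + 1) / 2" using that by (simp add: field_simps)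
  moreover have "real p + 1 \<le> ?\<nu>" if "(real n + 1) / 2 \<le> real p"
    using that by (simp add: field_simps)
  ultimately show ?thesis
    unfolding first_eigenvalue_on_def using ev ge by (meson order_trans)
qed

end
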